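(* Let $X$ be a complex Banach space with open unit ball $\mathbb{B}$, let $A$ be a bounded strongly accretive linear operator on $X$, and let $g\in\mathrm{Hol}(\mathbb{D},\mathbb{C})$ be biholomorphic onto its image with $g\prec g_0$ and $\overline{V(A)}\subset g(\mathbb{D})$, where $g_0(z)=\frac{1+z}{1-z}$. Let $x\in\partial\mathbb{B}$, $\ell_x\in T(x)$ and $\tau=g^{-1}(\ell_x(Ax))$. Write $$g\left(\frac{\tau-z}{1-z\overline{\tau}}\right)=q_0+q_1z+q_2z^2+o(z^2).$$ Given $f\in\mathrm{Hol}(\mathbb{B},X)$ denote $$\widetilde{a}_2^2=\frac12\,\ell_x\left(D^2f(0)\left[x,D^2f(0)[x,Ax]\right]-\frac12 D^2f(0)\left[x,AD^2f(0)[x^2]\right]\right),$$ $$a_2=\frac1{2!}\,\ell_x\left(2D^2f(0)[x,Ax]-AD^2f(0)[x^2]\right),$$ $$a_3=\frac1{2\cdot 3!}\,\ell_x\left(3D^3f(0)[x^2,Ax]-AD^3f(0)[x^3]\right).$$ If $f\in\widehat{S}_g(\mathbb{B})$, then for any $\nu\in\mathbb{C}$ we have $$\left|a_3-(\nu-1)a_2^2-\widetilde{a}_2^2\right|\le\frac{|q_1|}{2}\max\left\{1,\left|\frac{q_2}{q_1}+2(\nu-1)q_1\right|\right\}.$$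
   Context: $\mathbb{D}$ is the open unit disk in $\mathbb{C}$; $\mathrm{Hol}(U,Y)$ is the set of holomorphic mappings from $U$ to $Y$. For $x\in X\setminus\{0\}$, $T(x)=\{\ell_x\in X^*:\|\ell_x\|=1,\ \ell_x(x)=\|x\|\}$. $D^nf(0)$ is the $n$-th Fréchet derivative at $0$, a bounded symmetric $n$-linear operator; $D^nf(0)[x^n]=D^nf(0)[x,\dots,x]$ and $D^nf(0)[x^{n-1},y]=D^nf(0)[x,\dots,x,y]$. A mapping $f$ is normalized if $f(0)=0$ and $Df(0)=\mathrm{Id}$. For a bounded linear operator $A$, $V(A)=\{\ell_x(Ax):\|x\|=1,\ \ell_x\in T(x)\}$ is its numerical range; $A$ is strongly accretive if there is $k>0$ with $\mathrm{Re}\,\ell_x(Ax)\ge k\|x\|$ for all $x\in X\setminus\{0\}$, $\ell_x\in T(x)$. For functions on $\mathbb{D}$, $g\prec g_0$ (subordination) means $g=g_0\circ\omega$ for some holomorphic $\omega:\mathbb{D}\to\mathbb{D}$ with $\omega(0)=0$. $\mathcal{N}_A$ is the set of $h\in\mathrm{Hol}(\mathbb{B},X)$ with $h(0)=0$, $Dh(0)=A$ and $\mathrm{Re}\,\ell_x(h(x))>0$ for all $x\in\mathbb{B}\setminus\{0\}$, $\ell_x\in T(x)$. $\mathcal{N}_A(g)$ is the set of $h\in\mathcal{N}_A$ with $\frac{\ell_x(h(x))}{\|x\|}\in g(\mathbb{D})$ for all $x\in\mathbb{B}\setminus\{0\}$, $\ell_x\in T(x)$. A mapping $f\in\mathrm{Hol}(\mathbb{B},X)$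 is biholomorphic if $f^{-1}$ exists and is holomorphic on $f(\mathbb{B})$. $\widehat{S}_A(\mathbb{B})$ is the set of normalized biholomorphic $f\in\mathrm{Hol}(\mathbb{B},X)$ that are spirallike relative to $A$, i.e. $e^{-tA}f(x)\in f(\mathbb{B})$ for all $t\ge0$, $x\in\mathbb{B}$. $\widehat{S}_g(\mathbb{B})=\{f\in\widehat{S}_A(\mathbb{B}):(Df)^{-1}Af\in\mathcal{N}_A(g)\}$, where $(Df)^{-1}Af$ is the mapping $x\mapsto [Df(x)]^{-1}Af(x)$. The symbol $\widetilde{a}_2^2$ denotes a single complex number (not the square of another defined quantity), while $a_2^2=(a_2)^2$. *)

theory Defs
  imports "HOL-Complex_Analysis.Complex_Analysis" "HOL-Library.Landau_Symbols"
begin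

class complex_normed_vector = real_normed_vector +
  fixes scaleC :: "complex \<Rightarrow> 'a \<Rightarrow> 'a"  (infixr "*\<^sub>C" 75)
  assumes scaleC_add_right: "a *\<^sub>C (x + y) = a *\<^sub>C x + a *\<^sub>C y"
    and scaleC_add_left: "(a + b) *\<^sub>C x = a *\<^sub>C x + b *\<^sub>C x"
    and scaleC_scaleC: "a *\<^sub>C (b *\<^sub>C x) = (a * b) *\<^sub>C x"
    and scaleC_of_real: "complex_of_real r *\<^sub>C x = r *\<^sub>R x"
    and norm_scaleC: "norm (a *\<^sub>C x) = cmod a * norm x"

class complex_banach = complex_normed_vector + complete_space
begin
subclass banach ..
end

instantiation complex :: complex_banach
begin
definition scaleC_complex :: "complex \<Rightarrow> complex \<Rightarrow> complex"
  where "scaleC_complex a z = a * z"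
instance
  by standard (auto simp: scaleC_complex_def algebra_simps norm_mult scaleR_conv_of_real)
end

definition complex_linear ::
    "('a::complex_normed_vector \<Rightarrow> 'b::complex_normed_vector) \<Rightarrow> bool"
  where "complex_linear L \<longleftrightarrow>
    (\<forall>x y. L (x + y) = L x + L y) \<and> (\<forall>c x. L (c *\<^sub>C x) = c *\<^sub>C L x)"

text \<open>
  The derivative is taken in the operator norm, so its iterates are the higher
  Frechet derivatives, in curried form: \<open>D\<^sup>2f(x)[u, v]\<close> is \<open>fderiv2 f x u v\<close>.
  It is unique when it exists. The real and the complex derivative of a holomorphic mapping
  coincide, so bounded real-linear operators suffice as values.
\<close>

definition fderiv ::
    "('a::real_normed_vector \<Rightarrow> 'b::real_normed_vector) \<Rightarrow> 'a \<Rightarrow> 'a \<Rightarrow>\<^sub>L 'b"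
  where "fderiv f x = (THE L. (f has_derivative blinfun_apply L) (at x))"

definition fderiv2 ::
    "('a::real_normed_vector \<Rightarrow> 'b::real_normed_vector) \<Rightarrow> 'a \<Rightarrow> 'a \<Rightarrow>\<^sub>L 'a \<Rightarrow>\<^sub>L 'b"
  where "fderiv2 f = fderiv (fderiv f)"

definition fderiv3 ::
    "('a::real_normed_vector \<Rightarrow> 'b::real_normed_vector) \<Rightarrow> 'a \<Rightarrow> 'a \<Rightarrow>\<^sub>L 'a \<Rightarrow>\<^sub>L 'a \<Rightarrow>\<^sub>L 'b"
  where "fderiv3 f = fderiv (fderiv2 f)"

text \<open>
  \<open>f \<in> Hol U\<close> constrains \<open>f\<close> on \<open>U\<close> only. Since \<open>U\<close> has to be open, a biholomorphic mapping
  (defined below) has an open image.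
\<close>

definition Hol ::
    "'a set \<Rightarrow> ('a::complex_normed_vector \<Rightarrow> 'b::complex_normed_vector) set"
  where "Hol U = {f. open U \<and>
    (\<forall>x\<in>U. \<exists>L. complex_linear L \<and> (f has_derivative L) (at x))}"

abbreviation unit_ball :: "'a::real_normed_vector set"  ("\<bbbB>")
  where "\<bbbB> \<equiv> ball 0 1"

abbreviation unit_disk :: "complex set"  ("\<bbbD>")
  where "\<bbbD> \<equiv> ball 0 1"

definition support_functionals :: "'a::complex_normed_vector \<Rightarrow> ('a \<Rightarrow>\<^sub>L complex) set"
  where "support_functionals x =
    {l. complex_linear (blinfun_apply l) \<and> norm l = 1 \<and> l x = complex_of_real (norm x)}"

definition numerical_range :: "('a::complex_normed_vector \<Rightarrow>\<^sub>L 'a) \<Rightarrow> complex set"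
  where "numerical_range A = {blinfun_apply l (A x) | l x. norm x = 1 \<and> l \<in> support_functionals x}"

definition strongly_accretive :: "('a::complex_normed_vector \<Rightarrow>\<^sub>L 'a) \<Rightarrow> bool"
  where "strongly_accretive A \<longleftrightarrow>
    (\<exists>k>0. \<forall>x. x \<noteq> 0 \<longrightarrow> (\<forall>l\<in>support_functionals x. Re (blinfun_apply l (A x)) \<ge> k * norm x))"

definition subordinate :: "(complex \<Rightarrow> complex) \<Rightarrow> (complex \<Rightarrow> complex) \<Rightarrow> bool"
  where "subordinate g g0 \<longleftrightarrow>
    (\<exists>w. w holomorphic_on \<bbbD> \<and> w ` \<bbbD> \<subseteq> \<bbbD> \<and> w 0 = 0 \<and> (\<forall>z\<in>\<bbbD>. g z = g0 (w z)))"

definition op_exp :: "('a::banach \<Rightarrow>\<^sub>L 'a) \<Rightarrow> 'a \<Rightarrow>\<^sub>L 'a"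
  where "op_exp B = (\<Sum>n. (1 / fact n) *\<^sub>R ((\<lambda>C. B o\<^sub>L C) ^^ n) id_blinfun)"

definition N_class :: "('a::complex_banach \<Rightarrow>\<^sub>L 'a) \<Rightarrow> ('a \<Rightarrow> 'a) set"
  where "N_class A = {h \<in> Hol \<bbbB>. h 0 = 0 \<and> fderiv h 0 = A \<and>
    (\<forall>x\<in>\<bbbB> - {0}. \<forall>l\<in>support_functionals x. Re (blinfun_apply l (h x)) > 0)}"

definition N_class_of ::
    "('a::complex_banach \<Rightarrow>\<^sub>L 'a) \<Rightarrow> (complex \<Rightarrow> complex) \<Rightarrow> ('a \<Rightarrow> 'a) set"
  where "N_class_of A g = {h \<in> N_class A.
    \<forall>x\<in>\<bbbB> - {0}. \<forall>l\<in>support_functionals x.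
      blinfun_apply l (h x) / complex_of_real (norm x) \<in> g ` \<bbbD>}"

definition biholomorphic :: "('a::complex_banach \<Rightarrow> 'a) \<Rightarrow> bool"
  where "biholomorphic f \<longleftrightarrow>
    f \<in> Hol \<bbbB> \<and> inj_on f \<bbbB> \<and> inv_into \<bbbB> f \<in> Hol (f ` \<bbbB>)"

definition normalized :: "('a::complex_banach \<Rightarrow> 'a) \<Rightarrow> bool"
  where "normalized f \<longleftrightarrow> f 0 = 0 \<and> fderiv f 0 = id_blinfun"

definition spirallike :: "('a::complex_banach \<Rightarrow>\<^sub>L 'a) \<Rightarrow> ('a \<Rightarrow> 'a) \<Rightarrow> bool"
  where "spirallike A f \<longleftrightarrow> (\<forall>t\<ge>0. \<forall>x\<in>\<bbbB>. op_exp (- (t *\<^sub>R A)) (f x) \<in> f ` \<bbbB>)"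

definition S_hat :: "('a::complex_banach \<Rightarrow>\<^sub>L 'a) \<Rightarrow> ('a \<Rightarrow> 'a) set"
  where "S_hat A = {f. normalized f \<and> biholomorphic f \<and> spirallike A f}"

text \<open>For biholomorphic \<open>f\<close> each \<open>fderiv f x\<close> with \<open>x\<close> in the ball is a bijection.\<close>

definition S_hat_of ::
    "('a::complex_banach \<Rightarrow>\<^sub>L 'a) \<Rightarrow> (complex \<Rightarrow> complex) \<Rightarrow> ('a \<Rightarrow> 'a) set"
  where "S_hat_of A g = {f \<in> S_hat A.
    (\<lambda>x. inv (blinfun_apply (fderiv f x)) (A (f x))) \<in> N_class_of A g}"

end

theory Submission imports Defs begin

text \<open>
  Along the ray through \<open>x\<close> the function \<open>l (h (z x)) / z\<close>, where \<open>h = (Df)\<^sup>-\<^sup>1 A f\<close>, maps the disk into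
  \<open>g(\<bbbD>)\<close> and takes the value \<open>g(\<tau>)\<close> at 0, so it is the composition of \<open>g((\<tau> - z) / (1 - z cnj \<tau>))\<close>
  with a Schwarz function. Comparing the Taylor coefficients of \<open>Df(y) h(y) = A f(y)\<close> turns the
  functional in question into \<open>- (q1 / 2) (w2 + \<mu> w1\<^sup>2)\<close> with \<open>\<mu> = q2 / q1 + 2 (\<nu> - 1) q1\<close>, where
  \<open>w1, w2\<close> are the coefficients of the Schwarz function, and \<open>|w2| \<le> 1 - |w1|\<^sup>2\<close>.
  The analytic prerequisite is that the derivative of a holomorphic mapping is again holomorphic in
  the operator norm. It is reduced to the Cauchy estimates for scalar functions on complex lines by
  a norming family of functionals.
\<close>

subsection \<open>Norming functionals\<close>

text \<open>\<open>Hol\<close> asserts only a first derivative at each point, whereas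
  \<open>fderiv2\<close> and \<open>fderiv3\<close> mean something only if \<open>fderiv f\<close>
  is itself differentiable in the operator norm. A complex line shows one direction and one
  functional at a time. Uniformity comes from the Cauchy constants: they depend only on a local
  bound for the norm of the mapping, so they are the same for all functionals of norm at most 1.
  Additivity of the derivative in the direction is invisible on a single line and needs its own
  argument.

  The form of the coefficients comes from h: \<open>- 2 * a2\<close> is the value of
  \<open>l\<close> at D^2 h(0)[x,x], and \<open>- 12 * (a3 - a2_tilde_sq)\<close> is its value at
  D^3 h(0)[x,x,x]. The number \<open>a2_tilde_sq\<close> collects the term D^2 f(0)[x, D^2
  h(0)[x,x]], which is quadratic in the second-order part of f but is not a function of
  \<open>a2\<close>; this is why it is subtracted from \<open>a3\<close>. The maximum in the bound
  arises because (1 - c) + c |\<mu>| with c = |w1|^2 is a convex combination of 1 and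
  |\<mu>|.\<close>

definition sublinear :: "('a::real_vector \<Rightarrow> real) \<Rightarrow> bool"
  where "sublinear q \<longleftrightarrow>
    (\<forall>x y. q (x + y) \<le> q x + q y) \<and> (\<forall>t>0. \<forall>x. q (t *\<^sub>R x) \<le> t * q x)"

lemma sublinear_add: "sublinear q \<Longrightarrow> q (x + y) \<le> q x + q y"
  by (simp add: sublinear_def)

text \<open>Applying the assumed inequality with factor \<open>1 / t\<close> to
  \<open>t *\<^sub>R x\<close> gives the converse, so the constructions below need only a one-sided
  check.\<close>

lemma sublinear_scale:
  assumes "sublinear q" "t > 0"
  shows "q (t *\<^sub>R x) = t * q x"
proof (rule antisym)
  show "q (t *\<^sub>R x) \<le> t * q x"
    using assms by (simp add: sublinear_def)
  have "q ((1 / t) *\<^sub>R (t *\<^sub>R x)) \<le> (1 / t) * q (t *\<^sub>R x)"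
    using assms unfolding sublinear_def by (metis zero_less_divide_1_iff)
  then show "t * q x \<le> q (t *\<^sub>R x)"
    using assms(2) by (simp add: field_simps)
qed

lemma sublinear_zero:
  assumes "sublinear q"
  shows "q 0 = 0"
  using sublinear_scale[OF assms, of 2 0] by simp

lemma sublinear_minus:
  assumes "sublinear q"
  shows "- q (- x) \<le> q x"
  using sublinear_add[OF assms, of x "- x"] sublinear_zero[OF assms] by simp

text \<open>The infimal convolution of \<open>q\<close> with the functional on the ray through
  \<open>- y\<close> that sends \<open>- t y\<close> to \<open>- t * q y\<close>. The choice t = 0
  keeps it below \<open>q\<close>; the choice t = 1 at the point \<open>- y\<close> pushes its value
  there down to at most \<open>- q y\<close>, as linearity along \<open>y\<close> demands.\<close>

definition slide :: "('a::real_vector \<Rightarrow> real) \<Rightarrow> 'a \<Rightarrow> 'a \<Rightarrow> real"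
  where "slide q y x = (INF t\<in>{0..}. q (x + t *\<^sub>R y) - t * q y)"

lemma slide_le:
  assumes "sublinear q" "t \<ge> 0"
  shows "slide q y x \<le> q (x + t *\<^sub>R y) - t * q y"
  unfolding slide_def
proof (rule cINF_lower)
  show "bdd_below ((\<lambda>t. q (x + t *\<^sub>R y) - t * q y) ` {0..})"
  proof (rule bdd_belowI2[where m = "- q (- x)"])
    fix s :: real
    assume "s \<in> {0..}"
    then have "q (s *\<^sub>R y) = s * q y"
      using sublinear_scale[OF assms(1), of s y] sublinear_zero[OF assms(1)] by (cases "s = 0") auto
    moreover have "q (s *\<^sub>R y) \<le> q (x + s *\<^sub>R y) + q (- x)"
      using sublinear_add[OF assms(1), of "x + s *\<^sub>R y" "- x"] by simp
    ultimately show "- q (- x) \<le> q (x + s *\<^sub>R y) - s * q y"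
      by simp
  qed
qed (use assms in auto)

lemma slide_greatest:
  assumes "\<And>t. t \<ge> 0 \<Longrightarrow> m \<le> q (x + t *\<^sub>R y) - t * q y"
  shows "m \<le> slide q y x"
  unfolding slide_def by (rule cINF_greatest) (use assms in auto)

text \<open>Parameters \<open>s\<close> and \<open>t\<close> for two summands combine to
  \<open>s + t\<close> for the sum, and scaling by \<open>c\<close> turns \<open>t\<close> into
  \<open>c * t\<close>; the subtracted multiples of \<open>q y\<close> then match exactly.\<close>

lemma sublinear_slide:
  assumes q: "sublinear q"
  shows "sublinear (slide q y)"
  unfolding sublinear_def
proof (intro conjI allI impI)
  fix x x'
  have "slide q y (x + x') - (q (x + s *\<^sub>R y) - s * q y) \<le> q (x' + t *\<^sub>R y) - t * q y"
    if "s \<ge> 0" "t \<ge> 0" for s t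
  proof -
    have "slide q y (x + x') \<le> q ((x + x') + (s + t) *\<^sub>R y) - (s + t) * q y"
      using slide_le[OF q, of "s + t"] that by simp
    also have "q ((x + x') + (s + t) *\<^sub>R y) = q ((x + s *\<^sub>R y) + (x' + t *\<^sub>R y))"
      by (simp add: algebra_simps)
    also have "\<dots> \<le> q (x + s *\<^sub>R y) + q (x' + t *\<^sub>R y)"
      by (rule sublinear_add[OF q])
    finally show ?thesis
      by (simp add: algebra_simps)
  qed
  then have "slide q y (x + x') - (q (x + s *\<^sub>R y) - s * q y) \<le> slide q y x'" if "s \<ge> 0" for s
    using that by (intro slide_greatest) auto
  then have "slide q y (x + x') - slide q y x' \<le> slide q y x"
    by (intro slide_greatest) (simp add: algebra_simps)
  then show "slide q y (x + x') \<le> slide q y x + slide q y x'"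
    by simp
next
  fix c :: real and x
  assume c: "c > 0"
  have "slide q y (c *\<^sub>R x) / c \<le> q (x + t *\<^sub>R y) - t * q y" if "t \<ge> 0" for t
  proof -
    have "slide q y (c *\<^sub>R x) \<le> q (c *\<^sub>R x + (c * t) *\<^sub>R y) - (c * t) * q y"
      using slide_le[OF q, of "c * t"] that c by simp
    also have "c *\<^sub>R x + (c * t) *\<^sub>R y = c *\<^sub>R (x + t *\<^sub>R y)"
      by (simp add: algebra_simps)
    also have "q \<dots> = c * q (x + t *\<^sub>R y)"
      using c by (rule sublinear_scale[OF q])
    finally show ?thesis
      using c by (simp add: field_simps)
  qed
  then have "slide q y (c *\<^sub>R x) / c \<le> slide q y x"
    by (rule slide_greatest)
  then show "slide q y (c *\<^sub>R x) \<le> c * slide q y x"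
    using c by (simp add: field_simps)
qed

text \<open>Zorn's lemma on the sublinear functionals below \<open>p\<close>. The pointwise infimum
  of a chain is finite because every member \<open>q\<close> satisfies
  \<open>- p (- x) \<le> q x\<close>.\<close>

lemma minimal_sublinear:
  fixes p :: "'a::real_vector \<Rightarrow> real"
  assumes p: "sublinear p"
  obtains q where "sublinear q" "\<And>x. q x \<le> p x"
    "\<And>r. sublinear r \<Longrightarrow> (\<And>x. r x \<le> q x) \<Longrightarrow> r = q"
proof -
  define S where "S = {q. sublinear q \<and> (\<forall>x. q x \<le> p x)}"
  \<comment> \<open>The order is reversed because Zorn's lemma supplies maximal elements.\<close>
  define P :: "('a \<Rightarrow> real) \<Rightarrow> ('a \<Rightarrow> real) \<Rightarrow> bool" where "P = (\<lambda>a b. \<forall>x. b x \<le> a x)"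
  have "\<exists>m\<in>S. \<forall>a\<in>S. P m a \<longrightarrow> a = m"
  proof (rule predicate_Zorn)
    show "partial_order_on S (relation_of P S)"
      by (rule partial_order_on_relation_ofI) (auto simp: P_def fun_eq_iff intro: order_trans order_antisym)
  next
    fix C
    assume C: "C \<in> Chains (relation_of P S)"
    then have CS: "C \<subseteq> S" and tot: "\<And>a b. a \<in> C \<Longrightarrow> b \<in> C \<Longrightarrow> P a b \<or> P b a"
      by (auto simp: Chains_def relation_of_def)
    show "\<exists>u\<in>S. \<forall>a\<in>C. P a u"
    proof (cases "C = {}")
      case True
      then show ?thesis
        using p by (auto simp: S_def)
    next
      case False
      define u where "u = (\<lambda>x. INF q\<in>C. q x)"
      have sub: "sublinear q" if "q \<in> C" for q
        using CS that by (auto simp: S_def)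
      have u_le: "u x \<le> q x" if "q \<in> C" for q x
        unfolding u_def
      proof (rule cINF_lower)
        show "bdd_below ((\<lambda>q. q x) ` C)"
        proof (rule bdd_belowI2[where m = "- p (- x)"])
          fix r
          assume "r \<in> C"
          then have "r (- x) \<le> p (- x)" "- r (- x) \<le> r x"
            using CS sublinear_minus by (auto simp: S_def)
          then show "- p (- x) \<le> r x"
            by linarith
        qed
      qed (rule that)
      have u_ge: "m \<le> u x" if "\<And>q. q \<in> C \<Longrightarrow> m \<le> q x" for m x
        unfolding u_def using False that by (intro cINF_greatest)
      have "sublinear u"
        unfolding sublinear_def
      proof (intro conjI allI impI)
        fix x y
        \<comment> \<open>Members that are nearly optimal at \<open>x\<close> and at
          \<open>y\<close> may differ; comparability in the chain gives a single one below
          both.\<close>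
        have "u (x + y) - q1 x \<le> q2 y" if q: "q1 \<in> C" "q2 \<in> C" for q1 q2
        proof -
          obtain q where "q \<in> C" "q x \<le> q1 x" "q y \<le> q2 y"
            using tot[OF q] q unfolding P_def by blast
          then show ?thesis
            using u_le[of q "x + y"] sublinear_add[OF sub[of q], of x y] by linarith
        qed
        then have "u (x + y) - q1 x \<le> u y" if "q1 \<in> C" for q1
          using that by (intro u_ge)
        then have "u (x + y) - u y \<le> u x"
          by (intro u_ge) (simp add: algebra_simps)
        then show "u (x + y) \<le> u x + u y"
          by simp
      next
        fix t :: real and x
        assume t: "t > 0"
        have "u (t *\<^sub>R x) / t \<le> q x" if "q \<in> C" for q
          using u_le[OF that, of "t *\<^sub>R x"] sublinear_scale[OF sub[OF that] t, of x] t
          by (simp add: field_simps)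
        then have "u (t *\<^sub>R x) / t \<le> u x"
          by (rule u_ge)
        then show "u (t *\<^sub>R x) \<le> t * u x"
          using t by (simp add: field_simps)
      qed
      moreover have "u x \<le> p x" for x
      proof -
        obtain q where "q \<in> C"
          using False by blast
        then show ?thesis
          using u_le[of q x] CS by (force simp: S_def intro: order_trans)
      qed
      ultimately show ?thesis
        using u_le by (auto simp: S_def P_def)
    qed
  qed
  then obtain q where q: "sublinear q" "\<And>x. q x \<le> p x"
    and min: "\<And>r. r \<in> S \<Longrightarrow> P q r \<Longrightarrow> r = q"
    by (auto simp: S_def)
  show thesis
  proof (rule that[OF q])
    fix r
    assume "sublinear r" "\<And>x. r x \<le> q x"
    then show "r = q"
      using min[of r] q(2) by (force simp: S_def P_def intro: order_trans)
  qed
qed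

text \<open>Hahn--Banach without partially defined functionals: a minimal sublinear functional is linear,
  because sliding it along any direction does not make it smaller.\<close>

lemma real_norming_functional:
  fixes v :: "'a::real_normed_vector"
  obtains u :: "'a \<Rightarrow> real" where "linear u" "\<And>x. u x \<le> norm x" "u v = norm v"
proof -
  have n: "sublinear (norm :: 'a \<Rightarrow> real)"
    by (auto simp: sublinear_def norm_triangle_ineq)
  \<comment> \<open>Starting from \<open>slide norm v\<close> instead of the norm builds in
    \<open>q (- v) \<le> - norm v\<close>, which becomes \<open>q v = norm v\<close> once
    \<open>q\<close> is odd.\<close>
  obtain q where q: "sublinear q" "\<And>x. q x \<le> slide norm v x"
    and min: "\<And>r. sublinear r \<Longrightarrow> (\<And>x. r x \<le> q x) \<Longrightarrow> r = q"
    using minimal_sublinear[OF sublinear_slide[OF n]] by metis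
  have "slide q y = q" for y
    by (rule min[OF sublinear_slide[OF q(1)]]) (use slide_le[OF q(1), of 0 y] in simp)
  then have "q x + q y \<le> q (x + y)" for x y
    using slide_le[OF q(1), of 1 y x] by (simp add: algebra_simps)
  then have add: "q (x + y) = q x + q y" for x y
    using sublinear_add[OF q(1), of x y] by (simp add: antisym)
  have neg: "q (- x) = - q x" for x
    using add[of x "- x"] sublinear_zero[OF q(1)] by simp
  have scale: "q (t *\<^sub>R x) = t * q x" for t x
  proof (cases t "0::real" rule: linorder_cases)
    case less
    then have "q (- ((- t) *\<^sub>R x)) = - ((- t) * q x)"
      using sublinear_scale[OF q(1), of "- t" x] neg[of "(- t) *\<^sub>R x"] by simp
    then show ?thesis
      by simp
  qed (use sublinear_scale[OF q(1)] sublinear_zero[OF q(1)] in auto)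
  have le: "q x \<le> norm x" for x
    using q(2)[of x] slide_le[OF n, of 0 v x] by simp
  have "q (- v) \<le> - norm v"
    using q(2)[of "- v"] slide_le[OF n, of 1 v "- v"] by simp
  then have "q v = norm v"
    using neg[of v] le[of v] by simp
  with add scale le show thesis
    by (intro that[of q] linearI) auto
qed

text \<open>A complex-linear functional is recovered from its real part \<open>u\<close> by l y = u
  y - i u(i y). Rotating \<open>l x\<close> onto the positive real axis reduces the bound on its
  modulus to the bound on \<open>u\<close>.\<close>

lemma complex_norming_functional:
  fixes v :: "'a::complex_normed_vector"
  obtains l :: "'a \<Rightarrow> complex"
  where "complex_linear l" "\<And>x. cmod (l x) \<le> norm x" "cmod (l v) = norm v"
proof -
  obtain u :: "'a \<Rightarrow> real" where u: "linear u" "\<And>x. u x \<le> norm x" "u v = norm v"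
    using real_norming_functional[of v] by blast
  define l where "l = (\<lambda>y. Complex (u y) (- u (\<i> *\<^sub>C y)))"
  have sp: "c *\<^sub>C y = Re c *\<^sub>R y + Im c *\<^sub>R (\<i> *\<^sub>C y)" for c and y :: 'a
  proof -
    have "c *\<^sub>C y = (of_real (Re c) + of_real (Im c) * \<i>) *\<^sub>C y"
      by (metis complex_eq mult.commute)
    then show ?thesis
      by (simp only: scaleC_add_left scaleC_of_real flip: scaleC_scaleC)
  qed
  have ii: "\<i> *\<^sub>C (\<i> *\<^sub>C y) = - y" for y :: 'a
    using scaleC_of_real[of "-1" y] by (simp add: scaleC_scaleC)
  have lin: "complex_linear l"
    unfolding complex_linear_def
  proof (intro conjI allI)
    fix x y
    show "l (x + y) = l x + l y"
      by (simp add: l_def scaleC_add_right linear_add[OF u(1)] complex_eq_iff)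
  next
    fix c and y :: 'a
    have "\<i> *\<^sub>C (c *\<^sub>C y) = c *\<^sub>C (\<i> *\<^sub>C y)"
      by (simp add: scaleC_scaleC mult.commute)
    then have "u (\<i> *\<^sub>C (c *\<^sub>C y)) = Re c * u (\<i> *\<^sub>C y) - Im c * u y"
      by (simp add: sp[of c "\<i> *\<^sub>C y"] ii linear_add[OF u(1)] linear_diff[OF u(1)] linear_cmul[OF u(1)])
    moreover have "u (c *\<^sub>C y) = Re c * u y + Im c * u (\<i> *\<^sub>C y)"
      by (simp add: sp[of c y] linear_add[OF u(1)] linear_cmul[OF u(1)])
    ultimately show "l (c *\<^sub>C y) = c *\<^sub>C l y"
      by (simp add: l_def scaleC_complex_def complex_eq_iff)
  qed
  have le: "cmod (l x) \<le> norm x" for x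
  proof -
    have "of_real (cmod w) = cnj (sgn w) * w" for w
    proof (cases "w = 0")
      case False
      then show ?thesis
        using complex_norm_square[of w] by (simp add: sgn_eq divide_simps power2_eq_square mult.commute)
    qed simp
    then have "of_real (cmod (l x)) = cnj (sgn (l x)) * l x" .
    also have "\<dots> = l (cnj (sgn (l x)) *\<^sub>C x)"
      using lin by (simp add: complex_linear_def scaleC_complex_def)
    finally have "cmod (l x) = u (cnj (sgn (l x)) *\<^sub>C x)"
      by (metis Re_complex_of_real complex.sel(1) l_def)
    also have "\<dots> \<le> cmod (sgn (l x)) * norm x"
      using u(2) by (metis norm_scaleC complex_mod_cnj)
    also have "\<dots> \<le> norm x"
      by (simp add: norm_sgn)
    finally show ?thesis .
  qed
  moreover have "norm v \<le> cmod (l v)"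
    using complex_Re_le_cmod[of "l v"] u(3) by (simp add: l_def)
  ultimately show thesis
    using that[OF lin] antisym by blast
qed

subsection \<open>Complex normed spaces\<close>

lemma bounded_bilinear_scaleC:
  "bounded_bilinear (scaleC :: complex \<Rightarrow> 'a::complex_normed_vector \<Rightarrow> 'a)"
proof
  show "\<exists>K. \<forall>a b. norm (a *\<^sub>C b :: 'a) \<le> norm a * norm b * K"
    by (rule exI[of _ 1]) (simp add: norm_scaleC)
qed (simp_all add: scaleC_add_left scaleC_add_right scaleR_conv_of_real scaleC_scaleC mult.commute
    flip: scaleC_of_real)

lemmas scaleC_zero_left = bounded_bilinear.zero_left[OF bounded_bilinear_scaleC]
lemmas scaleC_zero_right = bounded_bilinear.zero_right[OF bounded_bilinear_scaleC]

lemma scaleC_one: "1 *\<^sub>C (x :: 'a::complex_normed_vector) = x"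
  using scaleC_of_real[of 1 x] by simp

lemma complex_linear_add: "complex_linear L \<Longrightarrow> L (x + y) = L x + L y"
  and complex_linear_scale: "complex_linear L \<Longrightarrow> L (c *\<^sub>C x) = c *\<^sub>C L x"
  by (auto simp: complex_linear_def)

lemma complex_linear_imp_linear:
  assumes "complex_linear L"
  shows "linear L"
  using assms by (intro linearI) (auto simp: complex_linear_def simp flip: scaleC_of_real)

lemma complex_linear_diff: "complex_linear L \<Longrightarrow> L (x - y) = L x - L y"
  by (intro linear_diff complex_linear_imp_linear)

lemma complex_linear_scaleR: "complex_linear L \<Longrightarrow> L (r *\<^sub>R x) = r *\<^sub>R L x"
  by (intro linear_cmul complex_linear_imp_linear)

instantiation blinfun :: (real_normed_vector, complex_normed_vector) complex_normed_vector
begin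

lift_definition scaleC_blinfun :: "complex \<Rightarrow> 'a \<Rightarrow>\<^sub>L 'b \<Rightarrow> 'a \<Rightarrow>\<^sub>L 'b" is "\<lambda>c f x. c *\<^sub>C f x"
  by (rule bounded_linear_compose[OF bounded_bilinear.bounded_linear_right[OF bounded_bilinear_scaleC]])

instance
proof
  fix a b :: complex and L M :: "'a \<Rightarrow>\<^sub>L 'b" and r :: real
  show "a *\<^sub>C (L + M) = a *\<^sub>C L + a *\<^sub>C M"
    by transfer (simp add: scaleC_add_right)
  show "(a + b) *\<^sub>C L = a *\<^sub>C L + b *\<^sub>C L"
    by transfer (simp add: scaleC_add_left)
  show ab: "a *\<^sub>C b *\<^sub>C L = (a * b) *\<^sub>C L" for a b
    by transfer (simp add: scaleC_scaleC)
  show "complex_of_real r *\<^sub>C L = r *\<^sub>R L"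
    by transfer (simp add: scaleC_of_real)
  have le: "norm (a *\<^sub>C L) \<le> cmod a * norm L" for a and L :: "'a \<Rightarrow>\<^sub>L 'b"
    by (rule norm_blinfun_bound)
       (auto simp: scaleC_blinfun.rep_eq norm_scaleC mult.assoc norm_blinfun intro!: mult_left_mono)
  show "norm (a *\<^sub>C L) = cmod a * norm L"
  proof (cases "a = 0")
    case True
    then show ?thesis
      using le[of 0 L] by simp
  next
    case False
    have "inverse a *\<^sub>C a *\<^sub>C L = L"
      using False ab[of "inverse a" a] by (transfer, simp add: scaleC_scaleC scaleC_one)
    then have "norm L \<le> cmod (inverse a) * norm (a *\<^sub>C L)"
      using le[of "inverse a" "a *\<^sub>C L"] by simp
    then show ?thesis
      using False le[of a L] by (simp add: norm_inverse norm_divide field_simps)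
  qed
qed

end

instance blinfun :: (real_normed_vector, complex_banach) complex_banach ..

lemma complex_linear_blinfun_compose_apply:
  assumes "complex_linear l"
  shows "complex_linear (\<lambda>T. l (blinfun_apply T v))"
  using assms by (auto simp: complex_linear_def plus_blinfun.rep_eq scaleC_blinfun.rep_eq)

section \<open>Derivatives of holomorphic mappings and their restrictions to complex lines\<close>

lemma fderiv_eqI:
  assumes "(f has_derivative blinfun_apply L) (at x)"
  shows "fderiv f x = L"
  unfolding fderiv_def
proof (rule the_equality[where P = "\<lambda>L. (f has_derivative blinfun_apply L) (at x)", OF assms])
  fix M
  assume "(f has_derivative blinfun_apply M) (at x)"
  then show "M = L"
    using assms has_derivative_unique blinfun_apply_inject by blast
qed

lemma Hol_fderiv:
  assumes "f \<in> Hol U" "x \<in> U"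
  shows "(f has_derivative blinfun_apply (fderiv f x)) (at x)"
    and "complex_linear (blinfun_apply (fderiv f x))"
proof -
  obtain L where L: "complex_linear L" "(f has_derivative L) (at x)"
    using assms by (auto simp: Hol_def)
  then have "blinfun_apply (Blinfun L) = L"
    by (intro bounded_linear_Blinfun_apply has_derivative_bounded_linear)
  then show "(f has_derivative blinfun_apply (fderiv f x)) (at x)"
    "complex_linear (blinfun_apply (fderiv f x))"
    using fderiv_eqI[of f "Blinfun L" x] L by auto
qed

lemma Hol_open: "f \<in> Hol U \<Longrightarrow> open U"
  by (simp add: Hol_def)

lemma Hol_continuous_at:
  assumes "f \<in> Hol U" "x \<in> U"
  shows "isCont f x"
  using Hol_fderiv(1)[OF assms] has_derivative_continuous by blast

lemma Hol_locally_bounded: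
  assumes "f \<in> Hol U" "x \<in> U"
  obtains r M where "r > 0" "ball x r \<subseteq> U" "\<And>y. y \<in> ball x r \<Longrightarrow> norm (f y) \<le> M"
proof -
  obtain s where s: "s > 0" "ball x s \<subseteq> U"
    using Hol_open[OF assms(1)] assms(2) openE by blast
  obtain d where d: "d > 0" "\<And>y. dist y x < d \<Longrightarrow> dist (f y) (f x) < 1"
    using Hol_continuous_at[OF assms] unfolding continuous_at_eps_delta by (metis zero_less_one)
  have "norm (f y) \<le> norm (f x) + 1" if "y \<in> ball x (min s d)" for y
    using d(2)[of y] that norm_triangle_sub[of "f y" "f x"] by (simp add: dist_norm norm_minus_commute)
  then show thesis
    using that[of "min s d" "norm (f x) + 1"] s d(1) by (auto simp: subset_iff)
qed

text \<open>The chain rule yields only a real-linear map of the parameter; complex linearity of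
  \<open>l\<close> and of the derivative makes it multiplication by a complex number.\<close>

lemma Hol_line_derivative:
  assumes f: "f \<in> Hol U" and l: "complex_linear l" "bounded_linear l" and z: "x + z *\<^sub>C u \<in> U"
  shows "((\<lambda>z. l (f (x + z *\<^sub>C u))) has_field_derivative l (fderiv f (x + z *\<^sub>C u) u)) (at z)"
proof -
  have "((\<lambda>z. x + z *\<^sub>C u) has_derivative (\<lambda>z. z *\<^sub>C u)) (at z)"
    by (rule derivative_eq_intros bounded_linear_imp_has_derivative refl
        bounded_bilinear.bounded_linear_left[OF bounded_bilinear_scaleC])+ auto
  from has_derivative_compose[OF this Hol_fderiv(1)[OF f z]]
  have "((\<lambda>z. f (x + z *\<^sub>C u)) has_derivative (\<lambda>w. fderiv f (x + z *\<^sub>C u) (w *\<^sub>C u))) (at z)"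
    by simp
  from bounded_linear.has_derivative[OF l(2) this]
  show ?thesis
    unfolding has_field_derivative_def
    by (simp add: complex_linear_scale[OF Hol_fderiv(2)[OF f z]] complex_linear_scale[OF l(1)]
        scaleC_complex_def mult_commute_abs)
qed

lemma bounded_linear_of_contraction:
  assumes "complex_linear l" "\<And>x. norm (l x) \<le> norm x"
  shows "bounded_linear l"
  using assms by (intro bounded_linear_intro[of _ 1])
    (auto simp: complex_linear_add complex_linear_scaleR)

section \<open>Quantitative Taylor estimates on complex lines\<close>

text \<open>Around a point of modulus at most 1/2 the closed disk of radius 1/4 stays in the unit
  disk, so Cauchy's inequality bounds the n-th derivative there by
  \<open>fact n * M * 4 ^ n\<close>. This is \<open>4 * M\<close> for n = 1 and
  \<open>32 * M\<close> for n = 2; the latter controls the remainder.\<close>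

lemma disc_taylor:
  assumes hol: "p holomorphic_on ball 0 1" and M: "\<And>z. z \<in> ball 0 1 \<Longrightarrow> cmod (p z) \<le> M"
    and z: "cmod z \<le> 1 / 2"
  shows "cmod (p z - p 0 - deriv p 0 * z) \<le> 32 * M * (cmod z)\<^sup>2" "cmod (deriv p 0) \<le> 4 * M"
proof -
  have bd: "cmod ((deriv ^^ n) p w) \<le> fact n * M / (1 / 4) ^ n" if w: "cmod w \<le> 1 / 2" for n w
  proof (rule Cauchy_inequality)
    have sub: "cball w (1 / 4) \<subseteq> ball 0 1"
    proof
      fix y
      assume "y \<in> cball w (1 / 4)"
      then show "y \<in> ball 0 1"
        using w norm_triangle_sub[of y w] by (simp add: dist_norm norm_minus_commute)
    qed
    then show "p holomorphic_on ball w (1 / 4)" "continuous_on (cball w (1 / 4)) p"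
      using hol holomorphic_on_subset ball_subset_cball
      by (blast intro: holomorphic_on_imp_continuous_on)+
    show "cmod (p y) \<le> M" if "cmod (w - y) = 1 / 4" for y
      using that sub by (intro M) (auto simp: dist_norm subset_iff)
  qed simp
  have "cmod ((deriv ^^ 0) p z - (\<Sum>i\<le>1. (deriv ^^ i) p 0 * (z - 0) ^ i / fact i))
    \<le> (32 * M) * cmod (z - 0) ^ Suc 1 / fact 1"
  proof (rule complex_Taylor[where S = "cball 0 (1 / 2)" and f = "\<lambda>i. (deriv ^^ i) p"])
    fix i and w :: complex
    assume "w \<in> cball 0 (1 / 2)"
    then have "((deriv ^^ i) p has_field_derivative deriv ((deriv ^^ i) p) w) (at w)"
      using holomorphic_higher_deriv[OF hol, of i]
      by (intro holomorphic_derivI[where S = "ball 0 1"]) auto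
    then show "((deriv ^^ i) p has_field_derivative (deriv ^^ Suc i) p w) (at w within cball 0 (1 / 2))"
      by (auto intro: has_field_derivative_at_within)
  next
    fix w :: complex
    assume "w \<in> cball 0 (1 / 2)"
    then show "cmod ((deriv ^^ Suc 1) p w) \<le> 32 * M"
      using bd[of w 2] by (simp add: power2_eq_square numeral_2_eq_2)
  qed (use z in auto)
  then show "cmod (p z - p 0 - deriv p 0 * z) \<le> 32 * M * (cmod z)\<^sup>2"
    by (simp add: algebra_simps numeral_2_eq_2)
  show "cmod (deriv p 0) \<le> 4 * M"
    using bd[of 0 1] by simp
qed

text \<open>Rescaling \<open>u\<close> to length \<open>R\<close> reduces this to the unit disk. The
  constants see \<open>p\<close> only through its bound \<open>M\<close>, so one estimate serves a
  whole family of functionals.\<close>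

lemma line_taylor:
  fixes p :: "'a::complex_normed_vector \<Rightarrow> complex"
  assumes R: "R > 0" and M: "\<And>y. y \<in> ball x R \<Longrightarrow> cmod (p y) \<le> M"
    and dif: "\<And>y u. y \<in> ball x R \<Longrightarrow> (\<lambda>z. p (y + z *\<^sub>C u)) field_differentiable at 0"
  shows "norm u \<le> R / 2 \<Longrightarrow>
      cmod (p (x + u) - p x - deriv (\<lambda>z. p (x + z *\<^sub>C u)) 0) \<le> 32 * M * (norm u / R)\<^sup>2"
    and "cmod (deriv (\<lambda>z. p (x + z *\<^sub>C u)) 0) \<le> 4 * M * (norm u / R)"
proof -
  have "(norm u \<le> R / 2 \<longrightarrow>
      cmod (p (x + u) - p x - deriv (\<lambda>z. p (x + z *\<^sub>C u)) 0) \<le> 32 * M * (norm u / R)\<^sup>2) \<and>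
    cmod (deriv (\<lambda>z. p (x + z *\<^sub>C u)) 0) \<le> 4 * M * (norm u / R)"
  proof (cases "u = 0")
    case True
    then show ?thesis
      by (simp add: scaleC_zero_right)
  next
    case False
    define v where "v = (R / norm u) *\<^sub>R u"
    define q where "q = (\<lambda>z. p (x + z *\<^sub>C v))"
    define c where "c = norm u / R"
    have c: "c > 0"
      using False R by (simp add: c_def)
    have u: "u = of_real c *\<^sub>C v"
      unfolding scaleC_of_real using False R by (simp add: c_def v_def)
    have v: "norm v = R"
      using False R by (simp add: v_def)
    have inb: "x + z *\<^sub>C v \<in> ball x R" if "cmod z < 1" for z
      using that R v by (simp add: dist_norm norm_scaleC)
    \<comment> \<open>Differentiability is given only at parameter 0, but from every base point;
      moving the base point along the line yields it at \<open>z\<close>.\<close>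
    have "q field_differentiable at z" if "cmod z < 1" for z
    proof -
      have "(\<lambda>w. p ((x + z *\<^sub>C v) + w *\<^sub>C v)) field_differentiable at (z - z)"
        using dif[OF inb[OF that]] by simp
      then have "((\<lambda>w. p ((x + z *\<^sub>C v) + w *\<^sub>C v)) \<circ> (\<lambda>w. w - z)) field_differentiable at z"
        by (intro field_differentiable_compose derivative_intros) auto
      then show ?thesis
        by (simp add: q_def o_def add.assoc flip: scaleC_add_left)
    qed
    then have hol: "q holomorphic_on ball 0 1"
      by (auto simp: holomorphic_on_open field_differentiable_def)
    have qM: "cmod (q z) \<le> M" if "z \<in> ball 0 1" for z
      using that inb[of z] by (auto simp: q_def intro!: M)
    have "(q has_field_derivative deriv q 0) (at (of_real c * 0))"
      using holomorphic_derivI[OF hol, of 0] by simp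
    then have "((\<lambda>z. q (of_real c * z)) has_field_derivative deriv q 0 * of_real c) (at 0)"
      by (rule DERIV_chain2) (auto intro!: derivative_eq_intros)
    then have d: "deriv (\<lambda>z. p (x + z *\<^sub>C u)) 0 = deriv q 0 * of_real c"
      by (intro DERIV_imp_deriv) (simp add: q_def u scaleC_scaleC mult.commute)
    have q: "q 0 = p x" "q (of_real c) = p (x + u)"
      by (simp_all add: q_def u scaleC_zero_left)
    have "cmod (deriv q 0) \<le> 4 * M"
      by (rule disc_taylor(2)[OF hol qM, where z = 0]) auto
    then have "cmod (deriv q 0) * c \<le> 4 * M * c"
      using c by (intro mult_right_mono) auto
    moreover have "cmod (p (x + u) - p x - deriv q 0 * of_real c) \<le> 32 * M * c\<^sup>2" if "norm u \<le> R / 2"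
    proof -
      have "cmod (of_real c) \<le> 1 / 2"
        using that R c by (simp add: norm_divide c_def field_simps)
      from disc_taylor(1)[OF hol qM this] show ?thesis
        using c by (simp add: q)
    qed
    ultimately show ?thesis
      using c by (simp add: d norm_mult flip: c_def)
  qed
  then show "norm u \<le> R / 2 \<Longrightarrow>
      cmod (p (x + u) - p x - deriv (\<lambda>z. p (x + z *\<^sub>C u)) 0) \<le> 32 * M * (norm u / R)\<^sup>2"
    and "cmod (deriv (\<lambda>z. p (x + z *\<^sub>C u)) 0) \<le> 4 * M * (norm u / R)"
    by auto
qed

subsection \<open>Weak holomorphy\<close>

text \<open>The scalar Taylor estimates hold with the same constants for every functional in
  \<Lambda>, so norming turns them into norm estimates. Completeness supplies vector-valued
  directional derivatives; homogeneity and boundedness are inherited from the scalar ones. Any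
  norming family will do, so operator-valued mappings can be tested by evaluations at
  vectors.\<close>

lemma weakly_holomorphic_imp_Hol:
  fixes \<phi> :: "'a::complex_normed_vector \<Rightarrow> 'b::complex_banach"
  assumes U: "open U"
    and lin: "\<And>l. l \<in> \<Lambda> \<Longrightarrow> complex_linear l"
    and contr: "\<And>l y. l \<in> \<Lambda> \<Longrightarrow> cmod (l y) \<le> norm y"
    and norming: "\<And>y e. (\<And>l. l \<in> \<Lambda> \<Longrightarrow> cmod (l y) \<le> e) \<Longrightarrow> norm y \<le> e"
    and bdd: "\<And>x. x \<in> U \<Longrightarrow> \<exists>r>0. \<exists>M. \<forall>y\<in>ball x r. norm (\<phi> y) \<le> M"
    and dif: "\<And>l x u. l \<in> \<Lambda> \<Longrightarrow> x \<in> U \<Longrightarrow> (\<lambda>z. l (\<phi> (x + z *\<^sub>C u))) field_differentiable at 0"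
  shows "\<phi> \<in> Hol U"
proof -
  have "\<exists>L. complex_linear L \<and> (\<phi> has_derivative L) (at x0)" if x0: "x0 \<in> U" for x0
  proof -
    \<comment> \<open>The doubled radius leaves room for a ball of radius \<open>R\<close> around
      every base point in \<open>ball x0 R\<close>: additivity will compare derivatives at different
      base points.\<close>
    obtain R M where R: "R > 0" and RU: "ball x0 (2 * R) \<subseteq> U"
      and M: "\<And>y. y \<in> ball x0 (2 * R) \<Longrightarrow> norm (\<phi> y) \<le> M"
    proof -
      obtain r M where r: "r > 0" "\<And>y. y \<in> ball x0 r \<Longrightarrow> norm (\<phi> y) \<le> M"
        using bdd[OF x0] by blast
      obtain s where s: "s > 0" "ball x0 s \<subseteq> U"
        using U x0 openE by blast
      show thesis
        by (rule that[of "min r s / 2" M]) (use r s in \<open>auto simp: subset_iff\<close>)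
    qed
    have inU: "ball x R \<subseteq> ball x0 (2 * R)" if "x \<in> ball x0 R" for x
    proof
      fix y
      assume "y \<in> ball x R"
      then show "y \<in> ball x0 (2 * R)"
        using that dist_triangle[of x0 y x] by simp
    qed
    have M0: "M \<ge> 0"
      using M[of x0] R norm_ge_zero[of "\<phi> x0"] by (simp add: order_trans[rotated])
    define K where "K = 32 * M / R\<^sup>2"
    define B where "B = 4 * M / R"
    have K0: "K \<ge> 0" and B0: "B \<ge> 0"
      using M0 R by (auto simp: K_def B_def)
    define d where "d = (\<lambda>l x u. deriv (\<lambda>z. l (\<phi> (x + z *\<^sub>C u))) 0)"
    have tay: "norm u \<le> R / 2 \<Longrightarrow> cmod (l (\<phi> (x + u)) - l (\<phi> x) - d l x u) \<le> K * (norm u)\<^sup>2"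
      and dbd: "cmod (d l x u) \<le> B * norm u"
      if l: "l \<in> \<Lambda>" and x: "x \<in> ball x0 R" for l x u
    proof -
      have "cmod (l (\<phi> y)) \<le> M" if "y \<in> ball x R" for y
        using contr[OF l, of "\<phi> y"] M[of y] inU[OF x] that by force
      moreover have "(\<lambda>z. l (\<phi> (y + z *\<^sub>C u))) field_differentiable at 0" if "y \<in> ball x R" for y u
        using dif[OF l] inU[OF x] RU that by blast
      ultimately show "norm u \<le> R / 2 \<Longrightarrow>
          cmod (l (\<phi> (x + u)) - l (\<phi> x) - d l x u) \<le> K * (norm u)\<^sup>2"
        and "cmod (d l x u) \<le> B * norm u"
        using line_taylor[of R x "\<lambda>y. l (\<phi> y)" M u] R
        by (auto simp: d_def K_def B_def power_divide)
    qed
    have dhom: "d l x (c *\<^sub>C u) = c * d l x u" if l: "l \<in> \<Lambda>" and x: "x \<in> ball x0 R" for l x c u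
    proof -
      have "x \<in> U"
        using x inU[OF x] RU R by auto
      then have "((\<lambda>z. l (\<phi> (x + z *\<^sub>C u))) has_field_derivative d l x u) (at (c * 0))"
        using dif[OF l] by (simp add: d_def field_differentiable_derivI)
      then have "((\<lambda>z. l (\<phi> (x + (c * z) *\<^sub>C u))) has_field_derivative d l x u * c) (at 0)"
        by (rule DERIV_chain2) (auto intro!: derivative_eq_intros)
      then show ?thesis
        unfolding d_def by (intro DERIV_imp_deriv) (simp add: scaleC_scaleC mult.commute d_def)
    qed
    have "\<exists>y. \<forall>l\<in>\<Lambda>. l y = d l x u" if x: "x \<in> ball x0 R" for x u
    proof -
      \<comment> \<open>The steps tend to 0 and keep \<open>s n * norm u\<close> within
        \<open>R / 2\<close>, the range of the Taylor estimate; the \<open>+ 1\<close> covers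
        \<open>u = 0\<close>.\<close>
      define s where "s = (\<lambda>n. R / (2 * (norm u + 1)) * inverse (real (Suc n)))"
      define D where "D = (\<lambda>n. (1 / s n) *\<^sub>R (\<phi> (x + s n *\<^sub>R u) - \<phi> x))"
      have nu: "norm u + 1 > 0"
        by (simp add: add_nonneg_pos)
      have s0: "s n > 0" for n
        using R nu unfolding s_def by (intro mult_pos_pos divide_pos_pos) auto
      have s_lim: "(\<lambda>n. (K * (norm u)\<^sup>2) * s n) \<longlonglongrightarrow> 0"
        unfolding s_def by (intro tendsto_mult_right_zero LIMSEQ_inverse_real_of_nat)
      have su: "s n * norm u \<le> R / 2" for n
      proof -
        have "s n \<le> R / (2 * (norm u + 1))"
          unfolding s_def using R nu by (intro mult_right_le_one_le divide_nonneg_nonneg) (auto simp: field_simps)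
        then have "s n * norm u \<le> R / (2 * (norm u + 1)) * norm u"
          by (intro mult_right_mono) auto
        also have "\<dots> = R / 2 * (norm u / (norm u + 1))"
          by simp
        also have "\<dots> \<le> R / 2 * 1"
          using R nu by (intro mult_left_mono) (auto simp: field_simps)
        finally show ?thesis
          by simp
      qed
      have lD: "cmod (l (D n) - d l x u) \<le> K * (norm u)\<^sup>2 * s n" if l: "l \<in> \<Lambda>" for l n
      proof -
        have "cmod (l (\<phi> (x + s n *\<^sub>R u)) - l (\<phi> x) - d l x (s n *\<^sub>R u)) \<le> K * (norm (s n *\<^sub>R u))\<^sup>2"
          using su[of n] s0[of n] by (intro tay[OF l x]) auto
        moreover have "d l x (s n *\<^sub>R u) = of_real (s n) * d l x u"
          using dhom[OF l x, of "of_real (s n)" u] by (simp add: scaleC_of_real)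
        moreover have "l (\<phi> (x + s n *\<^sub>R u)) - l (\<phi> x) = of_real (s n) * l (D n)"
          using s0[of n] by (simp add: D_def complex_linear_scaleR[OF lin[OF l]]
              complex_linear_diff[OF lin[OF l]] scaleR_conv_of_real)
        ultimately have "cmod (of_real (s n) * (l (D n) - d l x u)) \<le> K * (s n * norm u)\<^sup>2"
          using s0[of n] by (simp add: algebra_simps)
        then have "s n * cmod (l (D n) - d l x u) \<le> s n * (K * (norm u)\<^sup>2 * s n)"
          using s0[of n] by (simp add: norm_mult power2_eq_square mult_ac)
        then show ?thesis
          using s0[of n] by simp
      qed
      \<comment> \<open>The quotients approach \<open>d l x u\<close> at a rate common to all
        \<open>l\<close>, so their mutual distances are small in norm before any limit vector is
        known.\<close>
      have "Cauchy D"
      proof (rule CauchyI)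
        fix e :: real
        assume "e > 0"
        then have "\<forall>\<^sub>F n in sequentially. K * (norm u)\<^sup>2 * s n < e / 3"
          using order_tendstoD(2)[OF s_lim, of "e / 3"] by simp
        then obtain N where N: "\<And>n. n \<ge> N \<Longrightarrow> K * (norm u)\<^sup>2 * s n < e / 3"
          by (auto simp: eventually_sequentially)
        have "norm (D m - D n) < e" if "m \<ge> N" "n \<ge> N" for m n
        proof -
          have "norm (D m - D n) \<le> 2 * e / 3"
          proof (rule norming)
            fix l
            assume l: "l \<in> \<Lambda>"
            have "cmod (l (D m - D n)) = cmod ((l (D m) - d l x u) - (l (D n) - d l x u))"
              by (simp add: complex_linear_diff[OF lin[OF l]])
            also have "\<dots> \<le> cmod (l (D m) - d l x u) + cmod (l (D n) - d l x u)"
              by (rule norm_triangle_ineq4)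
            also have "\<dots> \<le> 2 * e / 3"
              using lD[OF l, of m] lD[OF l, of n] N[OF that(1)] N[OF that(2)] by simp
            finally show "cmod (l (D m - D n)) \<le> 2 * e / 3" .
          qed
          then show ?thesis
            using \<open>e > 0\<close> by simp
        qed
        then show "\<exists>N. \<forall>m\<ge>N. \<forall>n\<ge>N. norm (D m - D n) < e"
          by blast
      qed
      then obtain y where y: "D \<longlonglongrightarrow> y"
        using Cauchy_convergent convergent_def by blast
      have "l y = d l x u" if l: "l \<in> \<Lambda>" for l
      proof (rule LIMSEQ_unique)
        show "(\<lambda>n. l (D n)) \<longlonglongrightarrow> l y"
          by (rule bounded_linear.tendsto[OF bounded_linear_of_contraction[OF lin[OF l] contr[OF l]] y])
        have "(\<lambda>n. l (D n) - d l x u) \<longlonglongrightarrow> 0"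
          by (rule Lim_null_comparison[OF always_eventually s_lim]) (use lD[OF l] in blast)
        then show "(\<lambda>n. l (D n)) \<longlonglongrightarrow> d l x u"
          using LIM_zero_iff by blast
      qed
      then show ?thesis
        by blast
    qed
    then obtain L where L: "\<And>x u l. x \<in> ball x0 R \<Longrightarrow> l \<in> \<Lambda> \<Longrightarrow> l (L x u) = d l x u"
      by metis
    have tayL: "norm (\<phi> (x + u) - \<phi> x - L x u) \<le> K * (norm u)\<^sup>2"
      if "x \<in> ball x0 R" "norm u \<le> R / 2" for x u
      by (rule norming) (use tay that L in \<open>simp add: complex_linear_diff[OF lin]\<close>)
    have Lbd: "norm (L x u) \<le> B * norm u" if "x \<in> ball x0 R" for x u
      by (rule norming) (use dbd that L in simp)
    have Lhom: "L x (c *\<^sub>C u) = c *\<^sub>C L x u" if x: "x \<in> ball x0 R" for x c u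
    proof -
      have "norm (L x (c *\<^sub>C u) - c *\<^sub>C L x u) \<le> 0"
        by (rule norming)
          (simp add: complex_linear_diff[OF lin] complex_linear_scale[OF lin] L[OF x] dhom[OF _ x] scaleC_complex_def)
      then show ?thesis
        by simp
    qed
    have LhomR: "L x (t *\<^sub>R u) = t *\<^sub>R L x u" if x: "x \<in> ball x0 R" for x t u
      using Lhom[OF x, of "of_real t" u] by (simp add: scaleC_of_real)
    \<comment> \<open>For \<open>norm u \<le> R / 2\<close> the quadratic remainder is at most
      \<open>K * R * norm u\<close>, which is added to the bound \<open>B\<close> for the linear
      part.\<close>
    define B' where "B' = B + K * R"
    have lip: "norm (\<phi> (x + u) - \<phi> x) \<le> B' * norm u" if x: "x \<in> ball x0 R" and u: "norm u \<le> R / 2" for x u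
    proof -
      have "norm (\<phi> (x + u) - \<phi> x) \<le> K * (norm u)\<^sup>2 + B * norm u"
        using tayL[OF x u] Lbd[OF x, of u] norm_triangle_sub[of "\<phi> (x + u) - \<phi> x" "L x u"] by linarith
      also have "K * (norm u)\<^sup>2 \<le> K * (R * norm u)"
        unfolding power2_eq_square using u R K0 by (intro mult_left_mono mult_right_mono) auto
      finally show ?thesis
        by (simp add: B'_def algebra_simps)
    qed
    have B'0: "B' \<ge> 0"
      using B0 K0 R by (simp add: B'_def)
    have x0R: "x0 \<in> ball x0 R"
      using R by simp
    txt \<open>Walking from \<open>x0\<close> first along \<open>t u\<close> and then along \<open>t v\<close> compares \<open>L x0 (u + v)\<close> with
      \<open>L x0 u + L x1 v\<close>, where \<open>x1 = x0 + t u\<close>. Continuity of \<open>L\<close> in the base point comes from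
      difference quotients with the larger step \<open>s\<close>, where \<open>t = s\<^sup>2\<close>.\<close>
    have add: "L x0 (u + v) = L x0 u + L x0 v" for u v
    proof (rule ccontr)
      define w where "w = L x0 (u + v) - L x0 u - L x0 v"
      assume "L x0 (u + v) \<noteq> L x0 u + L x0 v"
      then have w: "norm w > 0"
        by (simp add: w_def algebra_simps)
      define N where "N = norm u + norm v + 1"
      have N: "N \<ge> 1" "norm u \<le> N" "norm v \<le> N" "norm (u + v) \<le> N"
        using norm_triangle_ineq[of u v] by (auto simp: N_def)
      \<comment> \<open>Three Taylor errors with step \<open>t \<le> s\<close> and two with step
        \<open>s\<close> give \<open>5 * K * N\<^sup>2\<close>. The two increments along
        \<open>t *\<^sub>R u\<close>, each at most \<open>B' * t * N\<close>, give
        \<open>2 * B' * N\<close> after division by \<open>s\<close>, since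
        \<open>t = s\<^sup>2\<close>.\<close>
      define C where "C = 5 * K * N\<^sup>2 + 2 * B' * N"
      have C0: "C \<ge> 0"
        using K0 B'0 N by (simp add: C_def)
      have bound: "norm w \<le> C * s" if s: "s > 0" "s \<le> 1" "s * N \<le> R / 2" for s
      proof -
        define t where "t = s\<^sup>2"
        have t: "t > 0" "t \<le> s"
          using s by (auto simp: t_def power2_eq_square mult_left_le)
        then have tN: "t * N \<le> R / 2"
          using s(3) N(1) mult_right_mono[OF t(2), of N] by linarith
        have small: "norm (r *\<^sub>R y) \<le> r * N" "norm (r *\<^sub>R y) \<le> R / 2" "(norm (r *\<^sub>R y))\<^sup>2 \<le> r\<^sup>2 * N\<^sup>2"
          if "r > 0" "r * N \<le> R / 2" "norm y \<le> N" for r and y :: 'a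
        proof -
          show 1: "norm (r *\<^sub>R y) \<le> r * N"
            using that by simp
          then show "norm (r *\<^sub>R y) \<le> R / 2"
            using that(2) by linarith
          show "(norm (r *\<^sub>R y))\<^sup>2 \<le> r\<^sup>2 * N\<^sup>2"
            using power_mono[OF 1, of 2] by (simp add: power_mult_distrib)
        qed
        have T: "norm (\<phi> (x + r *\<^sub>R y) - \<phi> x - r *\<^sub>R L x y) \<le> K * (r\<^sup>2 * N\<^sup>2)"
          if x: "x \<in> ball x0 R" and r: "r > 0" "r * N \<le> R / 2" "norm y \<le> N" for x y r
        proof -
          have "norm (\<phi> (x + r *\<^sub>R y) - \<phi> x - L x (r *\<^sub>R y)) \<le> K * (norm (r *\<^sub>R y))\<^sup>2"
            by (rule tayL[OF x small(2)[OF r]])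
          also have "\<dots> \<le> K * (r\<^sup>2 * N\<^sup>2)"
            by (rule mult_left_mono[OF small(3)[OF r] K0])
          finally show ?thesis
            by (simp add: LhomR[OF x])
        qed
        have Lp: "norm (\<phi> (x + t *\<^sub>R u) - \<phi> x) \<le> B' * (t * N)" if x: "x \<in> ball x0 R" for x
          using lip[OF x small(2)[OF t(1) tN N(2)]] mult_left_mono[OF small(1)[OF t(1) tN N(2)] B'0]
          by linarith
        define x1 where "x1 = x0 + t *\<^sub>R u"
        have x1: "x1 \<in> ball x0 R"
          using small(2)[OF t(1) tN N(2)] R by (simp add: x1_def dist_norm)
        have x2: "x0 + s *\<^sub>R v \<in> ball x0 R"
          using small(2)[OF s(1,3) N(3)] R by (simp add: dist_norm)
        define E1 where "E1 = \<phi> (x0 + t *\<^sub>R (u + v)) - \<phi> x0 - t *\<^sub>R L x0 (u + v)"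
        define E2 where "E2 = \<phi> (x0 + t *\<^sub>R u) - \<phi> x0 - t *\<^sub>R L x0 u"
        define E3 where "E3 = \<phi> (x1 + t *\<^sub>R v) - \<phi> x1 - t *\<^sub>R L x1 v"
        have "t *\<^sub>R (L x0 (u + v) - L x0 u - L x1 v) = E2 + E3 - E1"
          by (simp add: E1_def E2_def E3_def x1_def algebra_simps)
        then have "t * norm (L x0 (u + v) - L x0 u - L x1 v) = norm (E2 + E3 - E1)"
          using t by (metis abs_of_pos norm_scaleR)
        also have "\<dots> \<le> norm E2 + norm E3 + norm E1"
          using norm_triangle_ineq[of E2 E3] norm_triangle_ineq4[of "E2 + E3" E1] by linarith
        also have "\<dots> \<le> t * (3 * K * N\<^sup>2 * t)"
          using T[OF x0R t(1) tN N(4)] T[OF x0R t(1) tN N(2)] T[OF x1 t(1) tN N(3)]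
          by (simp add: E1_def E2_def E3_def power2_eq_square mult_ac)
        finally have p1: "norm (L x0 (u + v) - L x0 u - L x1 v) \<le> 3 * K * N\<^sup>2 * t"
          using t by simp
        define F1 where "F1 = \<phi> (x1 + s *\<^sub>R v) - \<phi> x1 - s *\<^sub>R L x1 v"
        define F2 where "F2 = \<phi> (x0 + s *\<^sub>R v) - \<phi> x0 - s *\<^sub>R L x0 v"
        define G1 where "G1 = \<phi> ((x0 + s *\<^sub>R v) + t *\<^sub>R u) - \<phi> (x0 + s *\<^sub>R v)"
        define G2 where "G2 = \<phi> (x0 + t *\<^sub>R u) - \<phi> x0"
        have "s *\<^sub>R (L x1 v - L x0 v) = (F2 - F1) + (G1 - G2)"
          by (simp add: F1_def F2_def G1_def G2_def x1_def algebra_simps)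
        then have "s * norm (L x1 v - L x0 v) = norm ((F2 - F1) + (G1 - G2))"
          using s by (metis abs_of_pos norm_scaleR)
        also have "\<dots> \<le> (norm F2 + norm F1) + (norm G1 + norm G2)"
          by (intro norm_triangle_le add_mono norm_triangle_ineq4)
        also have "\<dots> \<le> s * (2 * K * N\<^sup>2 * s + 2 * B' * N * s)"
          using T[OF x1 s(1,3) N(3)] T[OF x0R s(1,3) N(3)] Lp[OF x2] Lp[OF x0R]
          by (simp add: F1_def F2_def G1_def G2_def t_def power2_eq_square algebra_simps)
        finally have p2: "norm (L x1 v - L x0 v) \<le> 2 * K * N\<^sup>2 * s + 2 * B' * N * s"
          using s by simp
        have w_eq: "w = (L x0 (u + v) - L x0 u - L x1 v) + (L x1 v - L x0 v)"
          by (simp add: w_def)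
        have "norm w \<le> 3 * K * N\<^sup>2 * t + (2 * K * N\<^sup>2 * s + 2 * B' * N * s)"
          unfolding w_eq
          using p1 p2 norm_triangle_ineq[of "L x0 (u + v) - L x0 u - L x1 v" "L x1 v - L x0 v"] by linarith
        also have "3 * K * N\<^sup>2 * t \<le> 3 * K * N\<^sup>2 * s"
          using t K0 by (intro mult_left_mono) auto
        finally show ?thesis
          by (simp add: C_def algebra_simps)
      qed
      \<comment> \<open>The last entry brings \<open>C * s\<close> down to half of
        \<open>norm w\<close>, the contradiction; the other two keep the step admissible for
        \<open>bound\<close>.\<close>
      define s where "s = min (min 1 (R / (2 * N))) (norm w / (2 * (C + 1)))"
      have "s > 0"
        using R N w C0 by (simp add: s_def)
      moreover have "s \<le> 1"
        by (simp add: s_def)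
      moreover have "s * N \<le> R / 2"
      proof -
        have "s \<le> R / (2 * N)"
          by (simp add: s_def)
        then show ?thesis
          using N by (simp add: field_simps)
      qed
      ultimately have "norm w \<le> C * s"
        by (rule bound)
      also have "\<dots> \<le> (C + 1) * (norm w / (2 * (C + 1)))"
        using C0 \<open>s > 0\<close> by (intro mult_mono) (auto simp: s_def)
      also have "\<dots> = norm w / 2"
        using C0 by (simp add: field_simps)
      finally show False
        using w by simp
    qed
    have clin: "complex_linear (L x0)"
      using add Lhom[OF x0R] by (simp add: complex_linear_def)
    have "(\<phi> has_derivative L x0) (at x0)"
      unfolding has_derivative_at
    proof
      show "bounded_linear (L x0)"
        by (rule bounded_linear_intro[where K = B])
          (use add LhomR[OF x0R] Lbd[OF x0R] in \<open>auto simp: mult.commute\<close>)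
      have "\<forall>\<^sub>F h in at 0. norm (norm (\<phi> (x0 + h) - \<phi> x0 - L x0 h) / norm h) \<le> K * norm h"
        unfolding eventually_at
      proof (intro exI[of _ "R / 2"] conjI ballI impI)
        fix h :: 'a
        assume "h \<noteq> 0 \<and> dist h 0 < R / 2"
        then show "norm (norm (\<phi> (x0 + h) - \<phi> x0 - L x0 h) / norm h) \<le> K * norm h"
          using tayL[OF x0R, of h] by (simp add: field_simps power2_eq_square)
      qed (use R in simp)
      moreover have "((\<lambda>h. K * norm h) \<longlongrightarrow> 0) (at (0::'a))"
        by (intro tendsto_mult_right_zero tendsto_norm_zero) simp
      ultimately show "(\<lambda>h. norm (\<phi> (x0 + h) - \<phi> x0 - L x0 h) / norm h) \<midarrow>0\<rightarrow> 0"
        by (rule Lim_null_comparison)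
    qed
    with clin show ?thesis
      by blast
  qed
  then show ?thesis
    using U by (simp add: Hol_def)
qed

section \<open>Holomorphy of the derivative in the operator norm\<close>

lemma fderiv_line:
  assumes f: "f \<in> Hol U" and x: "x \<in> U"
    and l: "complex_linear l" "\<And>y. cmod (l y) \<le> norm y"
  shows "(\<lambda>z. l (f (x + z *\<^sub>C u))) field_differentiable at 0"
    and "deriv (\<lambda>z. l (f (x + z *\<^sub>C u))) 0 = l (fderiv f x u)"
proof -
  have "((\<lambda>z. l (f (x + z *\<^sub>C u))) has_field_derivative l (fderiv f (x + 0 *\<^sub>C u) u)) (at 0)"
    by (rule Hol_line_derivative[OF f l(1) bounded_linear_of_contraction[OF l]])
      (use x in \<open>simp_all add: scaleC_zero_left\<close>)
  then show "(\<lambda>z. l (f (x + z *\<^sub>C u))) field_differentiable at 0"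
    "deriv (\<lambda>z. l (f (x + z *\<^sub>C u))) 0 = l (fderiv f x u)"
    by (auto simp: scaleC_zero_left field_differentiable_def intro: DERIV_imp_deriv)
qed

text \<open>The functionals sending \<open>T\<close> to \<open>l (T v)\<close> with
  \<open>norm v \<le> 1\<close> are norming for operators. Along a complex line, such a functional
  of \<open>fderiv f\<close> is a locally uniform limit of difference quotients of \<open>f\<close>
  in direction \<open>v\<close>. These are holomorphic in the line parameter, hence so is the
  limit.\<close>

lemma Hol_fderiv_Hol:
  fixes f :: "'a::complex_normed_vector \<Rightarrow> 'b::complex_banach"
  assumes f: "f \<in> Hol U"
  shows "fderiv f \<in> Hol U"
proof -
  define \<Lambda>0 where "\<Lambda>0 = {l :: 'b \<Rightarrow> complex. complex_linear l \<and> (\<forall>y. cmod (l y) \<le> norm y)}"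
  define \<Lambda> where "\<Lambda> = {(\<lambda>T :: 'a \<Rightarrow>\<^sub>L 'b. l (T v)) | l v. l \<in> \<Lambda>0 \<and> norm v \<le> 1}"
  have \<Lambda>0: "complex_linear l" "\<And>y. cmod (l y) \<le> norm y" if "l \<in> \<Lambda>0" for l
    using that by (auto simp: \<Lambda>0_def)
  \<comment> \<open>\<open>R\<close> and \<open>M\<close> are chosen before \<open>l\<close>,
    \<open>y\<close> and \<open>u\<close>; this uniformity gives both the local bound on
    \<open>fderiv f\<close> and the uniform limit.\<close>
  have taylor: "\<exists>R>0. \<exists>M\<ge>0. ball x (2 * R) \<subseteq> U \<and> (\<forall>l\<in>\<Lambda>0. \<forall>y\<in>ball x R. \<forall>u.
      (norm u \<le> R / 2 \<longrightarrow> cmod (l (f (y + u)) - l (f y) - l (fderiv f y u)) \<le> 32 * M * (norm u / R)\<^sup>2)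
      \<and> cmod (l (fderiv f y u)) \<le> 4 * M * (norm u / R))" if x: "x \<in> U" for x
  proof -
    obtain r M where r: "r > 0" "ball x r \<subseteq> U" and M: "\<And>y. y \<in> ball x r \<Longrightarrow> norm (f y) \<le> M"
      using Hol_locally_bounded[OF f x] by blast
    have "(norm u \<le> (r / 2) / 2 \<longrightarrow>
        cmod (l (f (y + u)) - l (f y) - l (fderiv f y u)) \<le> 32 * M * (norm u / (r / 2))\<^sup>2)
      \<and> cmod (l (fderiv f y u)) \<le> 4 * M * (norm u / (r / 2))"
      if l: "l \<in> \<Lambda>0" and y: "y \<in> ball x (r / 2)" for l y u
    proof -
      have in_r: "y' \<in> ball x r" if "y' \<in> ball y (r / 2)" for y'
        using that y dist_triangle[of x y' y] by simp
      have bound: "cmod (l (f y')) \<le> M" if "y' \<in> ball y (r / 2)" for y'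
        using \<Lambda>0(2)[OF l, of "f y'"] M[OF in_r[OF that]] by simp
      have dif: "(\<lambda>z. l (f (y' + z *\<^sub>C u))) field_differentiable at 0" if "y' \<in> ball y (r / 2)" for y' u
        using fderiv_line(1)[OF f _ \<Lambda>0[OF l]] in_r[OF that] r by blast
      have "deriv (\<lambda>z. l (f (y + z *\<^sub>C u))) 0 = l (fderiv f y u)"
        using fderiv_line(2)[OF f _ \<Lambda>0[OF l]] in_r[of y] r by auto
      then show ?thesis
        using line_taylor[where p = "\<lambda>y. l (f y)" and R = "r / 2" and M = M and x = y and u = u] bound dif r by auto
    qed
    moreover have "M \<ge> 0"
      using M[of x] r norm_ge_zero[of "f x"] by (simp add: order_trans[rotated])
    ultimately show ?thesis
      using r by (intro exI[of _ "r / 2"] conjI exI[of _ M]) auto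
  qed
  show ?thesis
  proof (rule weakly_holomorphic_imp_Hol[where \<Lambda> = \<Lambda>])
    show "open U"
      using f by (rule Hol_open)
    show "complex_linear l" if "l \<in> \<Lambda>" for l
      using that \<Lambda>0(1) by (auto simp: \<Lambda>_def intro: complex_linear_blinfun_compose_apply)
    show "cmod (l T) \<le> norm T" if l: "l \<in> \<Lambda>" for l T
    proof -
      obtain l0 v where l0: "l = (\<lambda>T. l0 (blinfun_apply T v))" "l0 \<in> \<Lambda>0" and v: "norm v \<le> 1"
        using l by (auto simp: \<Lambda>_def)
      have "cmod (l T) \<le> norm (blinfun_apply T v)"
        using \<Lambda>0(2)[OF l0(2)] by (simp add: l0(1))
      also have "\<dots> \<le> norm T * norm v"
        by (rule norm_blinfun)
      also have "\<dots> \<le> norm T"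
        using v by (simp add: mult_left_le)
      finally show ?thesis .
    qed
  next
    fix T :: "'a \<Rightarrow>\<^sub>L 'b" and e
    assume e: "\<And>l. l \<in> \<Lambda> \<Longrightarrow> cmod (l T) \<le> e"
    have le: "norm (blinfun_apply T v) \<le> e" if "norm v \<le> 1" for v
    proof -
      obtain l where l: "complex_linear l" "\<And>y. cmod (l y) \<le> norm y"
        and eq: "cmod (l (blinfun_apply T v)) = norm (blinfun_apply T v)"
        using complex_norming_functional[of "blinfun_apply T v"] by blast
      have "(\<lambda>T. l (blinfun_apply T v)) \<in> \<Lambda>"
        using l that by (auto simp: \<Lambda>_def \<Lambda>0_def)
      from e[OF this] show ?thesis
        by (simp add: eq)
    qed
    show "norm T \<le> e"
    proof (rule norm_blinfun_bound)
      show "0 \<le> e"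
        using le[of 0] by simp
      show "norm (blinfun_apply T v) \<le> e * norm v" for v
        using le[of "(1 / norm v) *\<^sub>R v"] by (cases "v = 0") (simp_all add: blinfun.scaleR_right field_simps)
    qed
  next
    fix x
    assume "x \<in> U"
    then obtain R M where R: "R > 0"
      and B: "\<And>l y u. l \<in> \<Lambda>0 \<Longrightarrow> y \<in> ball x R \<Longrightarrow> cmod (l (fderiv f y u)) \<le> 4 * M * (norm u / R)"
      using taylor by meson
    have "norm (fderiv f y) \<le> max 0 (4 * M / R)" if y: "y \<in> ball x R" for y
    proof (rule norm_blinfun_bound)
      fix u
      obtain l where l: "complex_linear l" "\<And>y. cmod (l y) \<le> norm y"
        and eq: "cmod (l (fderiv f y u)) = norm (fderiv f y u)"
        using complex_norming_functional[of "fderiv f y u"] by blast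
      have "l \<in> \<Lambda>0"
        using l by (simp add: \<Lambda>0_def)
      then have "norm (fderiv f y u) \<le> 4 * M / R * norm u"
        using B[OF _ y, of l u] by (simp add: eq)
      also have "\<dots> \<le> max 0 (4 * M / R) * norm u"
        by (intro mult_right_mono) auto
      finally show "norm (fderiv f y u) \<le> max 0 (4 * M / R) * norm u" .
    qed simp
    then show "\<exists>r>0. \<exists>M. \<forall>y\<in>ball x r. norm (fderiv f y) \<le> M"
      using R by blast
  next
    fix l and x u :: 'a
    assume l: "l \<in> \<Lambda>" and x: "x \<in> U"
    obtain l0 v where l0: "l = (\<lambda>T. l0 (blinfun_apply T v))" "l0 \<in> \<Lambda>0" and v: "norm v \<le> 1"
      using l by (auto simp: \<Lambda>_def)
    note l0_lin = \<Lambda>0(1)[OF l0(2)]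
    obtain R M where R: "R > 0" "ball x (2 * R) \<subseteq> U" and M0: "M \<ge> 0"
      and B: "\<And>y u. y \<in> ball x R \<Longrightarrow> norm u \<le> R / 2 \<Longrightarrow>
        cmod (l0 (f (y + u)) - l0 (f y) - l0 (fderiv f y u)) \<le> 32 * M * (norm u / R)\<^sup>2"
      using taylor[OF x] l0(2) by meson
    \<comment> \<open>For \<open>cmod z < \<rho>\<close> the point \<open>x + z *\<^sub>C u\<close>
      stays in \<open>ball x R\<close>, where the Taylor estimate applies.\<close>
    define \<rho> where "\<rho> = R / (norm u + 1)"
    define s where "s = (\<lambda>n. R / 2 * inverse (real (Suc n)))"
    define P where "P = (\<lambda>n z. (l0 (f ((x + s n *\<^sub>R v) + z *\<^sub>C u)) - l0 (f (x + z *\<^sub>C u))) / of_real (s n))"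
    define g where "g = (\<lambda>z. l (fderiv f (x + z *\<^sub>C u)))"
    have nu: "norm u + 1 > 0"
      by (simp add: add_nonneg_pos)
    have \<rho>: "\<rho> > 0"
      using R nu by (simp add: \<rho>_def)
    have s: "s n > 0" "s n \<le> R / 2" for n
    proof -
      show "s n > 0"
        using R by (simp add: s_def)
      have "inverse (real (Suc n)) \<le> 1"
        by (simp add: field_simps)
      then show "s n \<le> R / 2"
        unfolding s_def using R by (intro mult_left_le) auto
    qed
    have sv: "norm (s n *\<^sub>R v) \<le> s n" for n
      using s(1)[of n] v by (simp add: mult_left_le)
    have in_R: "x + z *\<^sub>C u \<in> ball x R" if "z \<in> ball 0 \<rho>" for z
    proof -
      have "cmod z * norm u \<le> cmod z * (norm u + 1)"
        by (intro mult_left_mono) auto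
      also have "\<dots> < \<rho> * (norm u + 1)"
        using that nu by (intro mult_strict_right_mono) auto
      also have "\<dots> = R"
        using nu by (simp add: \<rho>_def)
      finally show ?thesis
        by (simp add: dist_norm norm_scaleC)
    qed
    have in_U: "x + z *\<^sub>C u \<in> U" "(x + s n *\<^sub>R v) + z *\<^sub>C u \<in> U" if "z \<in> ball 0 \<rho>" for z n
    proof -
      have 1: "norm (z *\<^sub>C u) < R"
        using in_R[OF that] by (simp add: dist_norm)
      then show "x + z *\<^sub>C u \<in> U"
        using R by (intro subsetD[OF R(2)]) (simp add: dist_norm)
      have "norm (s n *\<^sub>R v + z *\<^sub>C u) < 2 * R"
        using 1 norm_triangle_ineq[of "s n *\<^sub>R v" "z *\<^sub>C u"] sv[of n] s[of n] R by linarith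
      then show "(x + s n *\<^sub>R v) + z *\<^sub>C u \<in> U"
        by (intro subsetD[OF R(2)])
          (metis add.assoc add_diff_cancel_left' dist_commute dist_norm mem_ball)
    qed
    have hol: "P n holomorphic_on ball 0 \<rho>" for n
    proof -
      have "(\<lambda>z. l0 (f (y + z *\<^sub>C u))) holomorphic_on ball 0 \<rho>"
        if "\<And>z. z \<in> ball 0 \<rho> \<Longrightarrow> y + z *\<^sub>C u \<in> U" for y
        unfolding holomorphic_on_open[OF open_ball]
        using Hol_line_derivative[OF f l0_lin bounded_linear_of_contraction[OF \<Lambda>0[OF l0(2)]] that]
        by blast
      from this[OF in_U(1)] this[OF in_U(2)[of _ n]] show ?thesis
        unfolding P_def by (intro holomorphic_intros) (use s[of n] in auto)
    qed
    \<comment> \<open>The Taylor remainder is quadratic in the increment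
      \<open>s n *\<^sub>R v\<close>; dividing by \<open>s n\<close> leaves a bound that tends to 0
      uniformly in \<open>z\<close>.\<close>
    have close: "cmod (P n z - g z) \<le> 32 * M / R\<^sup>2 * s n" if z: "z \<in> ball 0 \<rho>" for n z
    proof -
      let ?y = "x + z *\<^sub>C u"
      have "cmod (l0 (f (?y + s n *\<^sub>R v)) - l0 (f ?y) - l0 (fderiv f ?y (s n *\<^sub>R v)))
        \<le> 32 * M * (norm (s n *\<^sub>R v) / R)\<^sup>2"
        by (intro B in_R[OF z] order_trans[OF sv s(2)])
      also have "l0 (f (?y + s n *\<^sub>R v)) - l0 (f ?y) - l0 (fderiv f ?y (s n *\<^sub>R v)) = of_real (s n) * (P n z - g z)"
        using s(1)[of n] by (simp add: P_def g_def l0(1) blinfun.scaleR_right complex_linear_scaleR[OF l0_lin]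
          scaleR_conv_of_real field_simps)
      also have "32 * M * (norm (s n *\<^sub>R v) / R)\<^sup>2 \<le> 32 * M * (s n / R)\<^sup>2"
        using sv[of n] R M0 by (intro mult_left_mono power_mono divide_right_mono) auto
      finally have "s n * cmod (P n z - g z) \<le> s n * (32 * M / R\<^sup>2 * s n)"
        using s(1)[of n] by (simp add: norm_mult power_divide power2_eq_square mult_ac)
      then show ?thesis
        using s(1)[of n] by (rule mult_left_le_imp_le)
    qed
    have "g holomorphic_on ball 0 \<rho>"
    proof (rule holomorphic_uniform_sequence[OF open_ball hol])
      fix z :: complex
      assume "z \<in> ball 0 \<rho>"
      then obtain d where d: "d > 0" "cball z d \<subseteq> ball 0 \<rho>"
        using open_contains_cball by (metis open_ball)
      have "uniform_limit (cball z d) P g sequentially"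
      proof (rule uniform_limitI)
        fix e :: real
        assume "e > 0"
        have "(\<lambda>n. 32 * M / R\<^sup>2 * s n) \<longlonglongrightarrow> 0"
          unfolding s_def by (intro tendsto_mult_right_zero LIMSEQ_inverse_real_of_nat)
        then have "\<forall>\<^sub>F n in sequentially. 32 * M / R\<^sup>2 * s n < e"
          using \<open>e > 0\<close> by (rule order_tendstoD(2))
        then show "\<forall>\<^sub>F n in sequentially. \<forall>x\<in>cball z d. dist (P n x) (g x) < e"
        proof eventually_elim
          case (elim n)
          then show ?case
            unfolding dist_norm using close[of _ n] d(2) by (blast intro: le_less_trans)
        qed
      qed
      then show "\<exists>d>0. cball z d \<subseteq> ball 0 \<rho> \<and> uniform_limit (cball z d) P g sequentially"
        using d by blast
    qed
    then show "(\<lambda>z. l (fderiv f (x + z *\<^sub>C u))) field_differentiable at 0"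
      using \<rho> holomorphic_on_imp_differentiable_at[of g "ball 0 \<rho>" 0] by (simp add: g_def)
  qed
qed

subsection \<open>The equation for the generator along a ray\<close>

lemma fderiv2_Hol: "f \<in> Hol U \<Longrightarrow> fderiv2 f \<in> Hol U"
  and fderiv3_Hol: "f \<in> Hol U \<Longrightarrow> fderiv3 f \<in> Hol U"
  for f :: "'a::complex_normed_vector \<Rightarrow> 'b::complex_banach"
  by (simp_all add: fderiv2_def fderiv3_def Hol_fderiv_Hol)

lemma Hol_ray_derivative:
  assumes "f \<in> Hol U" "t *\<^sub>R x \<in> U"
  shows "((\<lambda>t. f (t *\<^sub>R x)) has_vector_derivative fderiv f (t *\<^sub>R x) x) (at t)"
proof -
  have "((\<lambda>t. t *\<^sub>R x) has_derivative (\<lambda>s. s *\<^sub>R x)) (at t)"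
    by (auto intro!: derivative_eq_intros)
  from has_derivative_compose[OF this Hol_fderiv(1)[OF assms]] show ?thesis
    by (simp add: has_vector_derivative_def blinfun.scaleR_right)
qed

lemmas has_vector_derivative_blinfun_apply =
  bounded_bilinear.has_vector_derivative[OF bounded_bilinear_blinfun_apply]

lemmas has_vector_derivative_blinfun_left =
  bounded_linear.has_vector_derivative[OF blinfun.bounded_linear_left]

lemmas has_vector_derivative_blinfun_right =
  bounded_linear.has_vector_derivative[OF blinfun.bounded_linear_right]

lemma vector_derivative_eqI:
  assumes "open S" "t \<in> S" "\<And>s. s \<in> S \<Longrightarrow> a s = b s"
    and "(a has_vector_derivative a') (at t)" "(b has_vector_derivative b') (at t)"
  shows "a' = b'"
  using has_vector_derivative_transform_within_open[OF assms(4,1,2,3)] assms(5)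
    vector_derivative_unique_at by blast

text \<open>The equation is differentiated two and three times along the real ray t x and evaluated
  at t = 0, where the derivatives of \<open>f\<close> and \<open>h\<close> of order at most one are
  known. Every differentiation adds \<open>x\<close> as a direction and leaves the factor from
  \<open>h\<close> in the last slot, which is the shape of the coefficients in the theorem.\<close>

lemma generator_derivatives:
  fixes f h :: "'a::complex_banach \<Rightarrow> 'a"
  assumes f: "f \<in> Hol \<bbbB>" and h: "h \<in> Hol \<bbbB>"
    and eq: "\<And>y. y \<in> \<bbbB> \<Longrightarrow> fderiv f y (h y) = blinfun_apply A (f y)"
    and f': "fderiv f 0 = id_blinfun" and h0: "h 0 = 0" and h': "fderiv h 0 = A"
    and x: "norm x \<le> 1"
  shows "fderiv2 h 0 x x = A (fderiv2 f 0 x x) - 2 *\<^sub>R fderiv2 f 0 x (A x)"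
    and "fderiv3 h 0 x x x =
      A (fderiv3 f 0 x x x) - 3 *\<^sub>R fderiv3 f 0 x x (A x) - 3 *\<^sub>R fderiv2 f 0 x (fderiv2 h 0 x x)"
proof -
  let ?I = "{-1<..<1::real}"
  have I: "t *\<^sub>R x \<in> \<bbbB>" if "t \<in> ?I" for t
  proof -
    have "\<bar>t\<bar> * norm x \<le> \<bar>t\<bar> * 1"
      using x by (intro mult_left_mono) auto
    then show ?thesis
      using that by auto
  qed
  note fH = f Hol_fderiv_Hol[OF f] fderiv2_Hol[OF f] fderiv3_Hol[OF f]
  note hH = h Hol_fderiv_Hol[OF h] fderiv2_Hol[OF h]
  note ray = Hol_ray_derivative[OF _ I]
  have P1: "((\<lambda>t. fderiv f (t *\<^sub>R x)) has_vector_derivative fderiv2 f (t *\<^sub>R x) x) (at t)"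
    and P2: "((\<lambda>t. fderiv2 f (t *\<^sub>R x) x) has_vector_derivative fderiv3 f (t *\<^sub>R x) x x) (at t)"
    and P3: "((\<lambda>t. fderiv3 f (t *\<^sub>R x) x x) has_vector_derivative
        fderiv (fderiv3 f) (t *\<^sub>R x) x x x) (at t)"
    and H1: "((\<lambda>t. h (t *\<^sub>R x)) has_vector_derivative fderiv h (t *\<^sub>R x) x) (at t)"
    and H2: "((\<lambda>t. fderiv h (t *\<^sub>R x) x) has_vector_derivative fderiv2 h (t *\<^sub>R x) x x) (at t)"
    and H3: "((\<lambda>t. fderiv2 h (t *\<^sub>R x) x x) has_vector_derivative fderiv3 h (t *\<^sub>R x) x x x) (at t)"
    and F1: "((\<lambda>t. A (f (t *\<^sub>R x))) has_vector_derivative A (fderiv f (t *\<^sub>R x) x)) (at t)"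
    and F2: "((\<lambda>t. A (fderiv f (t *\<^sub>R x) x)) has_vector_derivative A (fderiv2 f (t *\<^sub>R x) x x)) (at t)"
    and F3: "((\<lambda>t. A (fderiv2 f (t *\<^sub>R x) x x)) has_vector_derivative A (fderiv3 f (t *\<^sub>R x) x x x)) (at t)"
    if t: "t \<in> ?I" for t
    using ray[OF fH(1) t] ray[OF fH(2) t] ray[OF fH(3) t] ray[OF fH(4) t]
      ray[OF hH(1) t] ray[OF hH(2) t] ray[OF hH(3) t]
    by (auto simp: fderiv2_def[symmetric] fderiv3_def[symmetric]
        intro!: has_vector_derivative_blinfun_left has_vector_derivative_blinfun_right)
  note bil = has_vector_derivative_blinfun_apply and sum = has_vector_derivative_add
  have E0: "fderiv f (t *\<^sub>R x) (h (t *\<^sub>R x)) = A (f (t *\<^sub>R x))" if "t \<in> ?I" for t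
    using eq I[OF that] .
  have E1: "fderiv f (t *\<^sub>R x) (fderiv h (t *\<^sub>R x) x) + fderiv2 f (t *\<^sub>R x) x (h (t *\<^sub>R x))
      = A (fderiv f (t *\<^sub>R x) x)" if t: "t \<in> ?I" for t
    by (rule vector_derivative_eqI[OF _ t E0 bil[OF P1[OF t] H1[OF t]] F1[OF t]]) auto
  have E2: "(fderiv f (t *\<^sub>R x) (fderiv2 h (t *\<^sub>R x) x x) + fderiv2 f (t *\<^sub>R x) x (fderiv h (t *\<^sub>R x) x))
      + (fderiv2 f (t *\<^sub>R x) x (fderiv h (t *\<^sub>R x) x) + fderiv3 f (t *\<^sub>R x) x x (h (t *\<^sub>R x)))
      = A (fderiv2 f (t *\<^sub>R x) x x)" if t: "t \<in> ?I" for t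
    by (rule vector_derivative_eqI[OF _ t E1
          sum[OF bil[OF P1[OF t] H2[OF t]] bil[OF P2[OF t] H1[OF t]]] F2[OF t]]) auto
  have E3: "((fderiv f (t *\<^sub>R x) (fderiv3 h (t *\<^sub>R x) x x x) + fderiv2 f (t *\<^sub>R x) x (fderiv2 h (t *\<^sub>R x) x x))
      + (fderiv2 f (t *\<^sub>R x) x (fderiv2 h (t *\<^sub>R x) x x) + fderiv3 f (t *\<^sub>R x) x x (fderiv h (t *\<^sub>R x) x)))
      + ((fderiv2 f (t *\<^sub>R x) x (fderiv2 h (t *\<^sub>R x) x x) + fderiv3 f (t *\<^sub>R x) x x (fderiv h (t *\<^sub>R x) x))
      + (fderiv3 f (t *\<^sub>R x) x x (fderiv h (t *\<^sub>R x) x) + fderiv (fderiv3 f) (t *\<^sub>R x) x x x (h (t *\<^sub>R x))))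
      = A (fderiv3 f (t *\<^sub>R x) x x x)" if t: "t \<in> ?I" for t
    by (rule vector_derivative_eqI[OF _ t E2
          sum[OF sum[OF bil[OF P1[OF t] H3[OF t]] bil[OF P2[OF t] H2[OF t]]]
            sum[OF bil[OF P2[OF t] H2[OF t]] bil[OF P3[OF t] H1[OF t]]]] F3[OF t]]) auto
  have two: "2 *\<^sub>R y = y + y" and three: "3 *\<^sub>R y = y + y + y" for y :: 'a
    using scaleR_add_left[of 1 1 y] scaleR_add_left[of 2 1 y] by simp_all
  show "fderiv2 h 0 x x = A (fderiv2 f 0 x x) - 2 *\<^sub>R fderiv2 f 0 x (A x)"
    using E2[of 0] by (simp add: f' h0 h' two algebra_simps)
  show "fderiv3 h 0 x x x =
      A (fderiv3 f 0 x x x) - 3 *\<^sub>R fderiv3 f 0 x x (A x) - 3 *\<^sub>R fderiv2 f 0 x (fderiv2 h 0 x x)"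
    using E3[of 0] by (simp add: f' h0 h' three algebra_simps)
qed

text \<open>Differentiating \<open>f (F w) = w\<close> exhibits the derivative of the inverse
  \<open>F\<close> as a right inverse. Surjectivity makes the \<open>inv\<close> in
  \<open>S_hat_of\<close> pick a genuine preimage, which gives the equation
  \<open>fderiv f y (h y) = A (f y)\<close>.\<close>

lemma biholomorphic_surj_fderiv:
  assumes f: "biholomorphic f" and y: "y \<in> \<bbbB>"
  shows "surj (blinfun_apply (fderiv f y))"
proof -
  define F where "F = inv_into \<bbbB> f"
  have fH: "f \<in> Hol \<bbbB>" and inj: "inj_on f \<bbbB>" and FH: "F \<in> Hol (f ` \<bbbB>)"
    using f by (auto simp: biholomorphic_def F_def)
  have Ff: "F (f y) = y"
    using inj y by (simp add: F_def)
  have "(f has_derivative fderiv f y) (at (F (f y)))"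
    using Hol_fderiv(1)[OF fH y] by (simp add: Ff)
  moreover have "(F has_derivative fderiv F (f y)) (at (f y))"
    using y by (intro Hol_fderiv(1)[OF FH]) auto
  ultimately have "((\<lambda>w. f (F w)) has_derivative (\<lambda>v. fderiv f y (fderiv F (f y) v))) (at (f y))"
    by (rule has_derivative_compose[rotated])
  moreover have "((\<lambda>w. f (F w)) has_derivative (\<lambda>v. v)) (at (f y))"
    by (rule has_derivative_transform_within_open[OF has_derivative_ident Hol_open[OF FH]])
      (use y in \<open>auto simp: F_def f_inv_into_f\<close>)
  ultimately have "(\<lambda>v. fderiv f y (fderiv F (f y) v)) = (\<lambda>v. v)"
    by (rule has_derivative_unique)
  then show ?thesis
    by (metis surjI)
qed

subsection \<open>Coefficients of functions on the disk\<close>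

lemma deriv_eq_on_open:
  assumes "open S" "z \<in> S" "\<And>w. w \<in> S \<Longrightarrow> p w = q w" "(q has_field_derivative d) (at z)"
  shows "deriv p z = d"
  using assms has_field_derivative_transform_within_open[of q d z S p]
  by (intro DERIV_imp_deriv) auto

text \<open>In the Leibniz rule for \<open>z * k z\<close> only two terms survive. The induction
  runs over the whole disk, where the term with the factor \<open>z\<close> is still
  present.\<close>

lemma higher_deriv_times_id:
  assumes k: "k holomorphic_on ball 0 1" and p: "\<And>z. z \<in> ball 0 1 \<Longrightarrow> p z = z * k z"
  shows "(deriv ^^ Suc n) p 0 = of_nat (Suc n) * (deriv ^^ n) k 0"
proof -
  have "(deriv ^^ Suc n) p z = of_nat (Suc n) * (deriv ^^ n) k z + z * (deriv ^^ Suc n) k z"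
    if "z \<in> ball 0 1" for z
    using that
  proof (induction n arbitrary: z)
    case 0
    have "((\<lambda>z. z * k z) has_field_derivative k z + z * deriv k z) (at z)"
      by (rule derivative_eq_intros holomorphic_derivI[OF k] open_ball 0 refl)+ simp
    then show ?case
      using deriv_eq_on_open[OF open_ball 0 p] by simp
  next
    case (Suc n)
    have D: "((deriv ^^ m) k has_field_derivative (deriv ^^ Suc m) k z) (at z)" for m
      using holomorphic_derivI[OF holomorphic_higher_deriv[OF k open_ball, of m] open_ball Suc.prems]
      by simp
    have "((\<lambda>z. of_nat (Suc n) * (deriv ^^ n) k z + z * (deriv ^^ Suc n) k z)
      has_field_derivative of_nat (Suc (Suc n)) * (deriv ^^ Suc n) k z + z * (deriv ^^ Suc (Suc n)) k z) (at z)"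
      by (rule derivative_eq_intros D refl)+ (simp add: algebra_simps)
    from deriv_eq_on_open[OF open_ball Suc.prems Suc.IH this] show ?case
      by simp
  qed
  then show ?thesis
    by simp
qed

lemma deriv2_compose:
  assumes G: "G holomorphic_on ball 0 1" and w: "w holomorphic_on ball 0 1"
    and wD: "\<And>z. z \<in> ball 0 1 \<Longrightarrow> w z \<in> ball 0 1" and z: "z \<in> ball 0 1"
  shows "deriv (\<lambda>z. G (w z)) z = deriv G (w z) * deriv w z"
    and "deriv (deriv (\<lambda>z. G (w z))) z =
      deriv (deriv G) (w z) * (deriv w z)\<^sup>2 + deriv G (w z) * deriv (deriv w) z"
proof -
  have D: "(p has_field_derivative deriv p z) (at z)"
    if "p holomorphic_on ball 0 1" "z \<in> ball 0 1" for p and z :: complex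
    using holomorphic_derivI[OF that(1) open_ball that(2)] .
  have 1: "deriv (\<lambda>z. G (w z)) z = deriv G (w z) * deriv w z" if z: "z \<in> ball 0 1" for z
    by (rule DERIV_imp_deriv[OF DERIV_chain2[OF D[OF G wD[OF z]] D[OF w z]]])
  then show "deriv (\<lambda>z. G (w z)) z = deriv G (w z) * deriv w z"
    using z .
  have "((\<lambda>z. deriv G (w z) * deriv w z) has_field_derivative
      (deriv (deriv G) (w z) * deriv w z) * deriv w z + deriv (deriv w) z * deriv G (w z)) (at z)"
    by (intro DERIV_mult DERIV_chain2[where f = "deriv G" and g = w, OF D[OF holomorphic_deriv[OF G open_ball] wD[OF z]]]
        D[OF w z] D[OF holomorphic_deriv[OF w open_ball] z])
  from deriv_eq_on_open[OF open_ball z 1 this]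
  show "deriv (deriv (\<lambda>z. G (w z))) z =
      deriv (deriv G) (w z) * (deriv w z)\<^sup>2 + deriv G (w z) * deriv (deriv w) z"
    by (simp add: power2_eq_square mult_ac)
qed

text \<open>Splitting off the factor \<open>z\<close> twice leaves a holomorphic quotient whose
  value at 0 is the limit of \<open>E z / z\<^sup>2\<close>, hence 0. This is how the expansion in
  the theorem determines derivatives.\<close>

lemma smallo_square_derivs:
  assumes E: "E holomorphic_on ball 0 1" and o: "E \<in> o[at 0](\<lambda>z. z\<^sup>2)"
  shows "deriv E 0 = 0" "deriv (deriv E) 0 = 0"
proof -
  have lim: "((\<lambda>z. E z / z\<^sup>2) \<longlongrightarrow> 0) (at 0)"
    using o by (rule smalloD_tendsto)
  have cont: "(k \<longlongrightarrow> k 0) (at 0)" if "k holomorphic_on ball 0 1" for k :: "complex \<Rightarrow> complex"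
    using holomorphic_on_imp_continuous_on[OF that]
    by (metis at_within_open centre_in_ball continuous_on_def open_ball zero_less_one)
  have near: "\<forall>\<^sub>F z in at (0::complex). z \<in> ball 0 1 \<and> z \<noteq> 0"
    unfolding eventually_at by (intro exI[of _ 1]) auto
  have "((\<lambda>z. z\<^sup>2 * (E z / z\<^sup>2)) \<longlongrightarrow> 0) (at 0)"
    by (rule tendsto_eq_intros lim refl)+ simp
  then have "(E \<longlongrightarrow> 0) (at 0)"
    by (rule Lim_transform_eventually) (use near in eventually_elim, auto)
  then have E0: "E 0 = 0"
    using cont[OF E] tendsto_unique trivial_limit_at by blast
  obtain E1 where E1: "E1 holomorphic_on ball 0 1" "\<And>z. norm z < 1 \<Longrightarrow> E z = z * E1 z" "deriv E 0 = E1 0"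
    using Schwarz3[OF E E0] by blast
  have "((\<lambda>z. z * (E z / z\<^sup>2)) \<longlongrightarrow> 0) (at 0)"
    by (rule tendsto_eq_intros lim refl)+ simp
  then have "(E1 \<longlongrightarrow> 0) (at 0)"
    by (rule Lim_transform_eventually)
      (use near in eventually_elim, auto simp: E1 power2_eq_square)
  then have E10: "E1 0 = 0"
    using cont[OF E1(1)] tendsto_unique trivial_limit_at by blast
  obtain E2 where E2: "E2 holomorphic_on ball 0 1" "\<And>z. norm z < 1 \<Longrightarrow> E1 z = z * E2 z" "deriv E1 0 = E2 0"
    using Schwarz3[OF E1(1) E10] by blast
  have "(E2 \<longlongrightarrow> 0) (at 0)"
    by (rule Lim_transform_eventually[OF lim])
      (use near in eventually_elim, auto simp: E1 E2 power2_eq_square)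
  then have "E2 0 = 0"
    using cont[OF E2(1)] tendsto_unique trivial_limit_at by blast
  then show "deriv E 0 = 0" "deriv (deriv E) 0 = 0"
    using E1(3) E10 E2(3) higher_deriv_times_id[OF E1(1), of E 1] E1(2) by auto
qed

text \<open>This is the Schwarz-Pick inequality at 0 for \<open>h z = w z / z\<close>, because
  \<open>h 0\<close> and \<open>deriv h 0\<close> are the first two coefficients of
  \<open>w\<close>. If |h| attains 1, then \<open>h\<close> is constant; otherwise the Schwarz lemma
  applies to the Moebius transform of \<open>h\<close> that sends \<open>h 0\<close> to 0.\<close>

lemma schwarz_second_coefficient:
  assumes w: "w holomorphic_on ball 0 1" "w 0 = 0" and w1: "\<And>z. cmod z < 1 \<Longrightarrow> cmod (w z) < 1"
  shows "cmod (deriv (deriv w) 0 / 2) \<le> 1 - (cmod (deriv w 0))\<^sup>2"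
proof -
  obtain h where h: "h holomorphic_on ball 0 1" "\<And>z. norm z < 1 \<Longrightarrow> w z = z * h z" "deriv w 0 = h 0"
    using Schwarz3[OF w] by blast
  have d2: "deriv (deriv w) 0 = 2 * deriv h 0"
    using higher_deriv_times_id[OF h(1), of w 1] h(2) by simp
  have le: "cmod (h z) \<le> 1" if z: "cmod z < 1" for z
  proof (cases "z = 0")
    case True
    then show ?thesis
      using Schwarz_Lemma(2)[OF w w1, of 0] h(3) by simp
  next
    case False
    then show ?thesis
      using Schwarz_Lemma(1)[OF w w1 z] h(2)[OF z] by (simp add: norm_mult)
  qed
  have sq: "(cmod (h 0))\<^sup>2 \<le> 1"
    using le[of 0] by (simp add: power_le_one)
  show ?thesis
  proof (cases "\<exists>z. cmod z < 1 \<and> cmod (h z) = 1")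
    case True
    then obtain z0 where "cmod z0 < 1" "cmod (h z0) = 1"
      by blast
    then have "h constant_on ball 0 1"
      using le by (intro maximum_modulus_principle[where U = "ball 0 1" and \<xi> = z0, OF h(1)]) auto
    then obtain c where "\<And>z. z \<in> ball 0 1 \<Longrightarrow> h z = c"
      by (auto simp: constant_on_def)
    then have "deriv h 0 = 0"
      by (intro deriv_eq_on_open[OF open_ball[of 0 1], where q = "\<lambda>_. c"]) auto
    then show ?thesis
      using sq by (simp add: d2 h(3))
  next
    case False
    then have lt: "cmod (h z) < 1" if "cmod z < 1" for z
      using le[OF that] that by force
    let ?a = "h 0"
    define k where "k = (\<lambda>z. Moebius_function 0 ?a (h z))"
    have a: "cmod ?a < 1"
      using lt by simp
    have k1: "cmod (k z) < 1" if "cmod z < 1" for z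
      unfolding k_def by (rule Moebius_function_norm_lt_1[OF a lt[OF that]])
    have k0: "k 0 = 0"
      by (simp add: k_def Moebius_function_eq_zero)
    have khol: "k holomorphic_on ball 0 1"
      unfolding k_def
      by (rule holomorphic_on_compose_gen[OF h(1) Moebius_function_holomorphic[OF a], unfolded o_def])
        (use lt in auto)
    have nz: "1 - cnj ?a * ?a \<noteq> 0"
    proof
      assume "1 - cnj ?a * ?a = 0"
      then have "(cmod ?a)\<^sup>2 = 1"
        by (metis complex_norm_square eq_iff_diff_eq_0 mult.commute of_real_eq_1_iff of_real_power)
      then show False
        using a norm_ge_zero[of ?a] by (simp only: power2_eq_1_iff) linarith
    qed
    have h': "(h has_field_derivative deriv h 0) (at 0)"
      using holomorphic_derivI[OF h(1) open_ball] by simp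
    have "(k has_field_derivative (deriv h 0 * (1 - cnj ?a * ?a) - (?a - ?a) * (- (cnj ?a * deriv h 0)))
        / ((1 - cnj ?a * ?a) * (1 - cnj ?a * ?a))) (at 0)"
      unfolding k_def Moebius_function_simple
      by (rule derivative_eq_intros h' refl nz)+ simp
    then have "(k has_field_derivative deriv h 0 / (1 - cnj ?a * ?a)) (at 0)"
      using nz by simp
    then have "deriv k 0 = deriv h 0 / (1 - cnj ?a * ?a)"
      by (rule DERIV_imp_deriv)
    moreover have "1 - cnj ?a * ?a = of_real (1 - (cmod ?a)\<^sup>2)"
      using complex_norm_square[of ?a] by (simp add: mult.commute)
    moreover have "cmod (deriv k 0) \<le> 1"
      using Schwarz_Lemma(2)[OF khol k0 k1, of 0] by simp
    moreover have "(cmod ?a)\<^sup>2 < 1"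
      using a by (simp add: power_less_one_iff)
    ultimately have "cmod (deriv h 0) \<le> 1 - (cmod ?a)\<^sup>2"
      by (simp only: norm_divide norm_of_real) (simp add: divide_le_eq)
    then show ?thesis
      by (simp add: d2 h(3))
  qed
qed

text \<open>With \<open>c\<close> the squared modulus of the first coefficient, the triangle
  inequality gives a convex combination of 1 and \<open>cmod \<mu>\<close> with weights
  \<open>1 - c\<close> and \<open>c\<close>.\<close>

lemma schwarz_fekete_szego:
  assumes w: "w holomorphic_on ball 0 1" "w 0 = 0" and w1: "\<And>z. cmod z < 1 \<Longrightarrow> cmod (w z) < 1"
  shows "cmod (deriv (deriv w) 0 / 2 + \<mu> * (deriv w 0)\<^sup>2) \<le> max 1 (cmod \<mu>)"
proof -
  define c where "c = (cmod (deriv w 0))\<^sup>2"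
  have second: "cmod (deriv (deriv w) 0 / 2) \<le> 1 - c"
    unfolding c_def by (rule schwarz_second_coefficient[OF w w1])
  have c: "0 \<le> c" "c \<le> 1"
  proof -
    show "0 \<le> c"
      by (simp add: c_def)
    show "c \<le> 1"
      using second norm_ge_zero[of "deriv (deriv w) 0 / 2"] by linarith
  qed
  have "cmod (deriv (deriv w) 0 / 2 + \<mu> * (deriv w 0)\<^sup>2) \<le> (1 - c) * 1 + c * cmod \<mu>"
    using second norm_triangle_ineq[of "deriv (deriv w) 0 / 2" "\<mu> * (deriv w 0)\<^sup>2"]
    by (simp add: c_def norm_mult norm_power mult.commute)
  also have "\<dots> \<le> (1 - c) * max 1 (cmod \<mu>) + c * max 1 (cmod \<mu>)"
    using c by (intro add_mono mult_left_mono) auto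
  finally show ?thesis
    by (simp add: algebra_simps)
qed

section \<open>Complex rays, rotated support functionals and the disk automorphism\<close>

text \<open>The first-order rule on a line is iterated: after each step the next derivative of
  \<open>h\<close> is again in \<open>Hol\<close>, and evaluating it at \<open>x\<close> before
  applying \<open>l\<close> is again a complex-linear functional.\<close>

lemma Hol_ray_derivs:
  fixes h :: "'a::complex_banach \<Rightarrow> 'a"
  assumes h: "h \<in> Hol \<bbbB>" and l: "complex_linear (blinfun_apply l)" and x: "norm x \<le> 1"
  defines "p \<equiv> \<lambda>z. blinfun_apply l (h (z *\<^sub>C x))"
  shows "p holomorphic_on \<bbbD>" "deriv p 0 = l (fderiv h 0 x)"
    "deriv (deriv p) 0 = l (fderiv2 h 0 x x)" "deriv (deriv (deriv p)) 0 = l (fderiv3 h 0 x x x)"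
proof -
  have I: "z *\<^sub>C x \<in> \<bbbB>" if "z \<in> \<bbbD>" for z
  proof -
    have "cmod z * norm x \<le> cmod z * 1"
      using x by (intro mult_left_mono) auto
    then show ?thesis
      using that by (auto simp: norm_scaleC)
  qed
  have step: "((\<lambda>z. l' (k (z *\<^sub>C x))) has_field_derivative l' (fderiv k (z *\<^sub>C x) x)) (at z)"
    if "k \<in> Hol \<bbbB>" "complex_linear l'" "bounded_linear l'" "z \<in> \<bbbD>"
    for k :: "'a \<Rightarrow> 'b::complex_banach" and l' z
    using Hol_line_derivative[OF that(1-3), of 0 z x] I[OF that(4)] by simp
  have lin: "complex_linear (\<lambda>T. l (blinfun_apply T x))" "bounded_linear (\<lambda>T. l (blinfun_apply T x))"
    by (intro complex_linear_blinfun_compose_apply l bounded_linear_intros)+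
  have lin2: "complex_linear (\<lambda>T. l (blinfun_apply (blinfun_apply T x) x))"
    "bounded_linear (\<lambda>T. l (blinfun_apply (blinfun_apply T x) x))"
    using complex_linear_blinfun_compose_apply[OF lin(1), of x]
    by (intro bounded_linear_intros | simp)+
  have D1: "(p has_field_derivative l (fderiv h (z *\<^sub>C x) x)) (at z)" if "z \<in> \<bbbD>" for z
    unfolding p_def by (rule step[OF h l blinfun.bounded_linear_right that])
  have D2: "((\<lambda>z. l (fderiv h (z *\<^sub>C x) x)) has_field_derivative l (fderiv2 h (z *\<^sub>C x) x x)) (at z)"
    if "z \<in> \<bbbD>" for z
    using step[OF Hol_fderiv_Hol[OF h] lin that] by (simp add: fderiv2_def)
  have D3: "((\<lambda>z. l (fderiv2 h (z *\<^sub>C x) x x)) has_field_derivative l (fderiv3 h (z *\<^sub>C x) x x x)) (at z)"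
    if "z \<in> \<bbbD>" for z
    using step[OF fderiv2_Hol[OF h] lin2 that] by (simp add: fderiv3_def)
  show "p holomorphic_on \<bbbD>"
    unfolding holomorphic_on_open[OF open_ball] using D1 by blast
  have d1: "deriv p z = l (fderiv h (z *\<^sub>C x) x)" if "z \<in> \<bbbD>" for z
    by (rule DERIV_imp_deriv[OF D1[OF that]])
  have d2: "deriv (deriv p) z = l (fderiv2 h (z *\<^sub>C x) x x)" if "z \<in> \<bbbD>" for z
    by (rule deriv_eq_on_open[OF open_ball that d1 D2[OF that]])
  have d3: "deriv (deriv (deriv p)) z = l (fderiv3 h (z *\<^sub>C x) x x x)" if "z \<in> \<bbbD>" for z
    by (rule deriv_eq_on_open[OF open_ball that d2 D3[OF that]])
  show "deriv p 0 = l (fderiv h 0 x)"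
    "deriv (deriv p) 0 = l (fderiv2 h 0 x x)" "deriv (deriv (deriv p)) 0 = l (fderiv3 h 0 x x x)"
    using d1[of 0] d2[of 0] d3[of 0] by (simp_all add: scaleC_zero_left)
qed

text \<open>The unimodular factor cancels the argument of \<open>z\<close>, so the condition in
  \<open>N_class_of\<close> at the point \<open>z *\<^sub>C x\<close> can be read through the fixed
  functional \<open>l\<close>.\<close>

lemma support_functionals_rotate:
  assumes l: "l \<in> support_functionals x" and z: "z \<noteq> 0"
  shows "(of_real (cmod z) / z) *\<^sub>C l \<in> support_functionals (z *\<^sub>C x)"
  using l z
  by (auto simp: support_functionals_def complex_linear_def scaleC_blinfun.rep_eq scaleC_complex_def
      norm_scaleC norm_divide algebra_simps add_divide_distrib)

text \<open>\<open>m\<close> is the negative of the Moebius function M for \<tau>. Since -M(-w) is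
  the Moebius function for -\<tau>, the inverse of M, applying \<open>m\<close> twice gives the
  identity.\<close>

lemma moebius_involution:
  assumes \<tau>: "cmod \<tau> < 1"
  defines "m \<equiv> \<lambda>z. (\<tau> - z) / (1 - z * cnj \<tau>)"
  shows "m holomorphic_on \<bbbD>" "\<And>z. z \<in> \<bbbD> \<Longrightarrow> m z \<in> \<bbbD>" "\<And>z. z \<in> \<bbbD> \<Longrightarrow> m (m z) = z"
proof -
  have m: "m z = - Moebius_function 0 \<tau> z" for z
    unfolding m_def Moebius_function_simple
    by (metis minus_diff_eq minus_divide_left mult.commute)
  show "m holomorphic_on \<bbbD>"
    unfolding m by (intro holomorphic_intros Moebius_function_holomorphic \<tau>)
  show "m z \<in> \<bbbD>" if "z \<in> \<bbbD>" for z
    using Moebius_function_norm_lt_1[OF \<tau>] that by (simp add: m)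
  show "m (m z) = z" if "z \<in> \<bbbD>" for z
  proof -
    have "m (m z) = Moebius_function 0 (- \<tau>) (Moebius_function 0 \<tau> z)"
      unfolding m[of "m z"] unfolding m Moebius_function_simple[of \<tau> "- _"] Moebius_function_simple[of "- \<tau>"]
      by (simp add: minus_divide_left)
    also have "\<dots> = z"
      using \<tau> that by (intro Moebius_function_compose) auto
    finally show ?thesis .
  qed
qed

section \<open>The coefficient estimate for the fixed direction \<open>x\<close>\<close>

theorem theorem4p1:
  fixes A :: "'a::complex_banach \<Rightarrow>\<^sub>L 'a"
    and g :: "complex \<Rightarrow> complex"
    and x :: 'a
    and l :: "'a \<Rightarrow>\<^sub>L complex"
    and f :: "'a \<Rightarrow> 'a"
    and \<tau> q0 q1 q2 a2 a2_tilde_sq a3 \<nu> :: complex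
  assumes "complex_linear (blinfun_apply A)"
    and "strongly_accretive A"
    and "g holomorphic_on \<bbbD>" and "inj_on g \<bbbD>" and "inv_into \<bbbD> g holomorphic_on g ` \<bbbD>"
    and "subordinate g (\<lambda>z. (1 + z) / (1 - z))"
    and "closure (numerical_range A) \<subseteq> g ` \<bbbD>"
    and "x \<in> frontier \<bbbB>"
    and "l \<in> support_functionals x"
    and "\<tau> = inv_into \<bbbD> g (l (A x))"
    and "(\<lambda>z. g ((\<tau> - z) / (1 - z * cnj \<tau>)) - (q0 + q1 * z + q2 * z\<^sup>2)) \<in> o[at 0](\<lambda>z. z\<^sup>2)"
    and "a2_tilde_sq = 1 / 2 * l (fderiv2 f 0 x (fderiv2 f 0 x (A x))
           - (1 / 2) *\<^sub>R fderiv2 f 0 x (A (fderiv2 f 0 x x)))"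
    and "a2 = 1 / fact 2 * l (2 *\<^sub>R fderiv2 f 0 x (A x) - A (fderiv2 f 0 x x))"
    and "a3 = 1 / (2 * fact 3) * l (3 *\<^sub>R fderiv3 f 0 x x (A x) - A (fderiv3 f 0 x x x))"
    and "f \<in> S_hat_of A g"
  shows "cmod (a3 - (\<nu> - 1) * a2\<^sup>2 - a2_tilde_sq)
    \<le> cmod q1 / 2 * max 1 (cmod (q2 / q1 + 2 * (\<nu> - 1) * q1))"
proof -
  define h where "h = (\<lambda>y. inv (blinfun_apply (fderiv f y)) (A (f y)))"
  have "f \<in> S_hat A" and hN: "h \<in> N_class_of A g"
    using assms(15) by (auto simp: S_hat_of_def h_def)
  then have bih: "biholomorphic f" and f': "fderiv f 0 = id_blinfun"
    by (auto simp: S_hat_def normalized_def)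
  have fH: "f \<in> Hol \<bbbB>"
    using bih by (simp add: biholomorphic_def)
  have hH: "h \<in> Hol \<bbbB>" and h0: "h 0 = 0" and h': "fderiv h 0 = A"
    using hN by (auto simp: N_class_of_def N_class_def)
  have eq: "fderiv f y (h y) = A (f y)" if "y \<in> \<bbbB>" for y
    unfolding h_def by (rule surj_f_inv_f[OF biholomorphic_surj_fderiv[OF bih that]])
  have x: "norm x = 1"
    using assms(8) closure_minimal[OF ball_subset_cball closed_cball, of "0 :: 'a" 1]
    by (auto simp: frontier_def interior_open)
  have l: "complex_linear (blinfun_apply l)"
    using assms(9) by (simp add: support_functionals_def)

  have lAx: "l (A x) \<in> g ` \<bbbD>"
    using assms(7,9) x closure_subset by (force simp: numerical_range_def)
  then have \<tau>D: "\<tau> \<in> \<bbbD>" and g\<tau>: "g \<tau> = l (A x)"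
    unfolding assms(10) by (rule inv_into_into, rule f_inv_into_f)
  define m where "m = (\<lambda>z. (\<tau> - z) / (1 - z * cnj \<tau>))"
  have m_hol: "m holomorphic_on \<bbbD>" and mD: "\<And>z. z \<in> \<bbbD> \<Longrightarrow> m z \<in> \<bbbD>"
    and mm: "\<And>z. z \<in> \<bbbD> \<Longrightarrow> m (m z) = z"
    using moebius_involution[of \<tau>] \<tau>D unfolding m_def by auto

  define G where "G = (\<lambda>z. g (m z))"
  have G_hol: "G holomorphic_on \<bbbD>"
    unfolding G_def using holomorphic_on_compose_gen[OF m_hol assms(3), unfolded o_def] mD by blast
  \<comment> \<open>Injectivity yields \<open>deriv G 0 \<noteq> 0\<close>, that is
    \<open>q1 \<noteq> 0\<close>, so the quotient \<open>q2 / q1\<close> is a genuine one.\<close>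
  have "inj_on G \<bbbD>"
  proof (rule inj_onI)
    fix u v
    assume uv: "u \<in> \<bbbD>" "v \<in> \<bbbD>" "G u = G v"
    then have "m u = m v"
      using assms(4) mD unfolding G_def inj_on_def by blast
    then show "u = v"
      using mm uv by metis
  qed
  then have "deriv G 0 \<noteq> 0"
    by (intro holomorphic_injective_imp_regular[OF G_hol]) auto
  have quad: "((\<lambda>z. q0 + q1 * z + q2 * z\<^sup>2) has_field_derivative q1 + 2 * q2 * z) (at z)"
    and lin: "((\<lambda>z. q1 + 2 * q2 * z) has_field_derivative 2 * q2) (at z)" for z
    by (auto intro!: derivative_eq_intros)
  define E where "E = (\<lambda>z. G z - (q0 + q1 * z + q2 * z\<^sup>2))"
  have E_hol: "E holomorphic_on \<bbbD>"
    unfolding E_def by (intro holomorphic_intros G_hol)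
  have G_der: "(G has_field_derivative deriv G z) (at z)"
    "(deriv G has_field_derivative deriv (deriv G) z) (at z)" if "z \<in> \<bbbD>" for z
    using holomorphic_derivI[OF G_hol open_ball that]
      holomorphic_derivI[OF holomorphic_deriv[OF G_hol open_ball] open_ball that] by auto
  have E1: "deriv E z = deriv G z - (q1 + 2 * q2 * z)" if "z \<in> \<bbbD>" for z
    unfolding E_def by (intro DERIV_imp_deriv DERIV_diff G_der that quad)
  have "deriv (deriv E) 0 = deriv (deriv G) 0 - 2 * q2"
    by (rule deriv_eq_on_open[where S = "\<bbbD>", OF open_ball _ E1 DERIV_diff[OF G_der(2) lin]]) auto
  moreover have "deriv E 0 = 0" "deriv (deriv E) 0 = 0"
    using smallo_square_derivs[OF E_hol] assms(11) by (auto simp: E_def G_def m_def)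
  ultimately have G1: "deriv G 0 = q1" and G2: "deriv (deriv G) 0 = 2 * q2"
    using E1[of 0] by auto
  have q1: "q1 \<noteq> 0"
    using \<open>deriv G 0 \<noteq> 0\<close> G1 by simp

  define p where "p = (\<lambda>z. l (h (z *\<^sub>C x)))"
  note p_derivs = Hol_ray_derivs[OF hH l, of x, folded p_def]
  have p_hol: "p holomorphic_on \<bbbD>"
    using p_derivs(1) x by simp
  have "p 0 = 0"
    by (simp add: p_def scaleC_zero_left h0 blinfun.zero_right)
  \<comment> \<open>\<psi> is \<open>p z / z\<close> with the singularity at 0 filled by
    \<open>deriv p 0 = l (A x)\<close>.\<close>
  then obtain \<psi> where \<psi>: "\<psi> holomorphic_on \<bbbD>" "\<And>z. cmod z < 1 \<Longrightarrow> p z = z * \<psi> z" "deriv p 0 = \<psi> 0"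
    using Schwarz3[OF p_hol] by blast
  have \<psi>0: "\<psi> 0 = l (A x)"
    using \<psi>(3) p_derivs(2) x by (simp add: h')
  \<comment> \<open>At 0 the value lies in the numerical range of \<open>A\<close>; elsewhere the
    rotated functional at \<open>z *\<^sub>C x\<close> evaluates to \<open>\<psi> z\<close>, since
    \<open>norm x = 1\<close>.\<close>
  have \<psi>g: "\<psi> z \<in> g ` \<bbbD>" if z: "z \<in> \<bbbD>" for z
  proof (cases "z = 0")
    case True
    then show ?thesis
      using lAx \<psi>0 by simp
  next
    case False
    let ?l = "(of_real (cmod z) / z) *\<^sub>C l"
    have nzx: "norm (z *\<^sub>C x) = cmod z"
      using x by (simp add: norm_scaleC)
    then have "z *\<^sub>C x \<in> \<bbbB> - {0}"
      using z False by auto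
    then have "?l (h (z *\<^sub>C x)) / of_real (norm (z *\<^sub>C x)) \<in> g ` \<bbbD>"
      using hN support_functionals_rotate[OF assms(9) False] unfolding N_class_of_def by blast
    moreover have "?l (h (z *\<^sub>C x)) / of_real (norm (z *\<^sub>C x)) = \<psi> z"
      using \<psi>(2)[of z] z False
      by (simp add: nzx scaleC_blinfun.rep_eq scaleC_complex_def flip: p_def[THEN fun_cong, simplified])
    ultimately show ?thesis
      by simp
  qed

  \<comment> \<open>As \<open>m\<close> is an involution, this solves
    \<open>\<psi> = G \<circ> w\<close> on the disk, and \<open>w 0 = m \<tau> = 0\<close> makes it
    a Schwarz function.\<close>
  define w where "w = (\<lambda>z. m (inv_into \<bbbD> g (\<psi> z)))"
  have invD: "inv_into \<bbbD> g (\<psi> z) \<in> \<bbbD>" if "z \<in> \<bbbD>" for z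
    by (rule inv_into_into[OF \<psi>g[OF that]])
  have w_hol: "w holomorphic_on \<bbbD>"
  proof -
    have "(\<lambda>z. inv_into \<bbbD> g (\<psi> z)) holomorphic_on \<bbbD>"
      using holomorphic_on_compose_gen[OF \<psi>(1) assms(5), unfolded o_def] \<psi>g by blast
    from holomorphic_on_compose_gen[OF this m_hol] show ?thesis
      using invD unfolding w_def o_def by blast
  qed
  have w0: "w 0 = 0"
    by (simp add: w_def \<psi>0 m_def flip: assms(10))
  have wD: "w z \<in> \<bbbD>" if "z \<in> \<bbbD>" for z
    unfolding w_def by (rule mD[OF invD[OF that]])
  have Gw: "\<psi> z = G (w z)" if "z \<in> \<bbbD>" for z
    using mm[OF invD[OF that]] \<psi>g[OF that] by (simp add: G_def w_def f_inv_into_f)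
  define w1 where "w1 = deriv w 0"
  define w2 where "w2 = deriv (deriv w) 0 / 2"
  have \<psi>_derivs: "deriv \<psi> 0 = q1 * w1" "deriv (deriv \<psi>) 0 = 2 * (q2 * w1\<^sup>2 + q1 * w2)"
  proof -
    have "(G \<circ> w) holomorphic_on \<bbbD>"
      by (rule holomorphic_on_compose_gen[OF w_hol G_hol]) (use wD in auto)
    then have Gw_der: "((\<lambda>z. G (w z)) has_field_derivative deriv (\<lambda>z. G (w z)) z) (at z)"
      "(deriv (\<lambda>z. G (w z)) has_field_derivative deriv (deriv (\<lambda>z. G (w z))) z) (at z)"
      if "z \<in> \<bbbD>" for z
      using that by (auto simp: o_def intro!: holomorphic_derivI[OF _ open_ball] holomorphic_deriv)
    have 1: "deriv \<psi> z = deriv (\<lambda>z. G (w z)) z" if "z \<in> \<bbbD>" for z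
      by (rule deriv_eq_on_open[OF open_ball that Gw Gw_der(1)[OF that]])
    then show "deriv \<psi> 0 = q1 * w1"
      using deriv2_compose(1)[OF G_hol w_hol wD, of 0] by (simp add: w0 G1 w1_def)
    have "deriv (deriv \<psi>) 0 = deriv (deriv (\<lambda>z. G (w z))) 0"
      by (rule deriv_eq_on_open[where S = "\<bbbD>", OF open_ball _ 1 Gw_der(2)]) auto
    then show "deriv (deriv \<psi>) 0 = 2 * (q2 * w1\<^sup>2 + q1 * w2)"
      using deriv2_compose(2)[OF G_hol w_hol wD, of 0]
      by (simp add: w0 G1 G2 w1_def w2_def algebra_simps)
  qed

  let ?D2 = "fderiv2 f 0 x" and ?D3 = "fderiv3 f 0 x x"
  note gen = generator_derivatives[OF fH hH eq f' h0 h', of x]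
  have H2: "l (fderiv2 h 0 x x) = - 2 * a2"
    unfolding assms(13) using gen(1) x
    by (simp add: blinfun.diff_right blinfun.scaleR_right scaleR_conv_of_real fact_2)
  \<comment> \<open>The factor 12 is \<open>2 * fact 3\<close> from \<open>a3\<close>. Inserting the
    formula for \<open>fderiv2 h 0 x x\<close> into the last term of \<open>gen(2)\<close> leaves
    exactly \<open>12 * a2_tilde_sq\<close>.\<close>
  have H3: "l (fderiv3 h 0 x x x) = - 12 * (a3 - a2_tilde_sq)"
  proof -
    have "l (fderiv3 h 0 x x x) = l (A (?D3 x)) - 3 * l (?D3 (A x)) - 3 * l (?D2 (fderiv2 h 0 x x))"
      using gen(2) x by (simp add: blinfun.diff_right blinfun.scaleR_right scaleR_conv_of_real)
    moreover have "l (?D2 (fderiv2 h 0 x x)) = l (?D2 (A (?D2 x))) - 2 * l (?D2 (?D2 (A x)))"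
      using gen(1) x by (simp add: blinfun.diff_right blinfun.scaleR_right scaleR_conv_of_real)
    ultimately show ?thesis
      unfolding assms(12,14)
      by (simp add: blinfun.diff_right blinfun.scaleR_right scaleR_conv_of_real fact_numeral algebra_simps)
  qed
  \<comment> \<open>Since \<open>p z = z * \<psi> z\<close>, the second derivative of
    \<open>p\<close> at 0 is twice the first of \<psi>; likewise the third is three times the second
    in \<open>coeff3\<close>.\<close>
  have "- 2 * a2 = 2 * (q1 * w1)"
    using higher_deriv_times_id[OF \<psi>(1), of p 1] \<psi>(2) p_derivs(3) x H2 \<psi>_derivs(1) by simp
  then have a2: "a2 = - (q1 * w1)"
    using minus_equation_iff[of a2 "q1 * w1"] by auto
  have coeff3: "- 12 * (a3 - a2_tilde_sq) = 3 * (2 * (q2 * w1\<^sup>2 + q1 * w2))"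
    using higher_deriv_times_id[OF \<psi>(1), of p 2] \<psi>(2) p_derivs(4) x H3 \<psi>_derivs(2)
    by (simp add: numeral_2_eq_2)
  have "a3 - a2_tilde_sq = (- 12 * (a3 - a2_tilde_sq)) / (- 12)"
    by (simp add: field_simps)
  also have "\<dots> = - (q2 * w1\<^sup>2 + q1 * w2) / 2"
    unfolding coeff3 by (simp add: field_simps)
  finally have a3: "a3 - a2_tilde_sq = - (q2 * w1\<^sup>2 + q1 * w2) / 2" .
  have "a3 - (\<nu> - 1) * a2\<^sup>2 - a2_tilde_sq = (a3 - a2_tilde_sq) - (\<nu> - 1) * a2\<^sup>2"
    by simp
  \<comment> \<open>Substituting \<open>a2\<^sup>2 = q1\<^sup>2 * w1\<^sup>2\<close> and factoring
    out \<open>- (q1 / 2)\<close> turns \<open>\<nu> - 1\<close> into the summand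
    \<open>2 * (\<nu> - 1) * q1\<close> of the Fekete-Szego parameter.\<close>
  also have "\<dots> = - (q1 / 2) * (w2 + (q2 / q1 + 2 * (\<nu> - 1) * q1) * w1\<^sup>2)"
    unfolding a2 a3 using q1 by (simp add: field_simps power2_eq_square)
  finally have "cmod (a3 - (\<nu> - 1) * a2\<^sup>2 - a2_tilde_sq)
      = cmod q1 / 2 * cmod (w2 + (q2 / q1 + 2 * (\<nu> - 1) * q1) * w1\<^sup>2)"
    by (simp add: norm_mult norm_divide)
  also have "\<dots> \<le> cmod q1 / 2 * max 1 (cmod (q2 / q1 + 2 * (\<nu> - 1) * q1))"
    unfolding w1_def w2_def using wD
    by (intro mult_left_mono schwarz_fekete_szego[OF w_hol w0]) auto
  finally show ?thesis .
qed

end
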